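(* Suppose that $p\in W_2^1(0,T)$, $\Phi\in W_2^1(0,\ell)$, $f\in L_\infty(D)$. For $[g]_n\in\mathcal{G}_R^n$ and $n,m$ large enough, the discrete state vector $[v([g]_n)]_n$ satisfies $$\|[v]_n\|_{\mathcal{E}}^2:=\sum_{k=1}^n\tau\sum_{i=0}^{m-1}h\,v_{i\bar t}^2(k)+\max_{1\le k\le n}\Big(\sum_{i=0}^{m-1}h\,v_{ix}^2(k)\Big)+\sum_{k=1}^n\tau^2\sum_{i=0}^{m-1}h\,v_{ix\bar t}^2(k)$$ $$\le\tilde C_\infty\Big(\|\Phi\|_{W_2^1(0,\ell)}^2+\|f\|_{L_\infty(D)}^2+\|p\|_{W_2^1(0,T)}^2+\|g^n\|_{W_2^1(0,T)}^2\Big),$$ where $g^n=\mathcal{P}_n([g]_n)$ and $\tilde C_\infty$ is a constant independent of $n$ and $m$.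
   Context: **Data.** Fix $\ell,T,R>0$, $D=\{(x,t):0<x<\ell,\ 0<t\le T\}$, $J\ge1$, real numbers $u^1<\dots<u^J$, and positive numbers $\gamma_1,\dots,\gamma_J$. The functions $\alpha,k$ are positive and $C^1$ on each of the segments $(-\infty,u^1]$, $[u^j,u^{j+1}]$ ($j=1,\dots,J-1$), $[u^J,+\infty)$, with discontinuities of the first kind (jumps) at $u=u^j$, and satisfy $\int_{u^1}^{\infty}k(u)\,du=\infty$ and $\liminf_{u\to\infty}\alpha(u)/k(u)\ge a_0>0$. Put $F(u)=\int_{u^1}^{u}k(y)\,dy$, $v^j=F(u^j)$, $\beta(v)=\alpha(F^{-1}(v))/k(F^{-1}(v))$. Let $b$ be a function with $b'(v)=\beta(v)$ for $v\ne v^j$ and with jumps $b(v^j)^+-b(v^j)^-=\gamma_j$. The domain of $b$ is $\mathbb{R}$ and there is $\bar b>0$ with $b'(v)\ge\bar b$ for $v\ne v^j$ (and $b_n'(v)\ge\bar b$ for all $v$, with $b_n$ defined below). Standing assumption: each level set $\{x\in[0,\ell]:\Phi(x)=v^j\}$ has one-dimensional Lebesgue measure zero. **Norm.** $\|g\|_{W_2^1(0,T)}^2=\int_0^T(g^2+(g')^2)\,dt$, similarly on $(0,\ell)$. **Discretization.** For integers $n,m\ge1$ let $\tau=T/n$, $t_k=k\tau$, $h=\ell/m$, $x_i=ih$; $p_k=\frac1\tau\int_{t_{k-1}}^{t_k}p\,dt$, $g^n_k=\frac1\tau\int_{t_{k-1}}^{t_k}g^n\,dt$; $\Phi_i=\frac1h\int_{x_i}^{x_{i+1}}\Phi\,dx$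 ($0\le i\le m-1$), $\Phi_m=\Phi(\ell)$; $f_{ik}=\frac1{\tau h}\int_{t_{k-1}}^{t_k}\int_{x_i}^{x_{i+1}}f\,dx\,dt$. Difference quotients: $w_{ix}=(w_{i+1}-w_i)/h$, subscript $\bar t$ denotes $(w(k)-w(k-1))/\tau$, and $v_{ix\bar t}(k)=(v_{ix}(k)-v_{ix}(k-1))/\tau$. For $[g]_n=(g_0,\dots,g_n)\in\mathbb{R}^{n+1}$, $g_{k\bar t}=(g_k-g_{k-1})/\tau$, $\|[g]_n\|_{w_2^1}^2=\sum_{k=1}^n\tau g_k^2+\sum_{k=1}^n\tau g_{k\bar t}^2$, $\mathcal{G}_R^n=\{[g]_n\in\mathbb{R}^{n+1}:\|[g]_n\|_{w_2^1}\le R\}$. $\mathcal{P}_n([g]_n)=g^n$ with $g^n(t)=g_{k-1}+\frac{g_k-g_{k-1}}\tau(t-t_{k-1})$ for $t\in[t_{k-1},t_k)$, $k=1,\dots,n$. $b_n(v)=\int_{v-1/n}^{v+1/n}b(y)\,\omega_n(v-y)\,dy$ with $\omega_n(v)=C\,n\,e^{-1/(1-n^2v^2)}$ for $|v|<1/n$, $0$ otherwise, $C$ normalizing $\int_{\mathbb R}\omega_1=1$. **Discrete state vector.** Given $[g]_n$, $[v([g]_n)]_n=(v(0),\dots,v(n))$, $v(k)=(v_0(k),\dots,v_m(k))\in\mathbb{R}^{m+1}$, is the discrete state vector if $v_i(0)=\Phi_i$ for $0\le i\le m$ and for each $k=1,\dots,n$ $$\sum_{i=0}^{m-1}h\Big[\big(b_n(v_i(k))\big)_{\bar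 t}\,\eta_i+v_{ix}(k)\eta_{ix}-f_{ik}\eta_i\Big]-p_k\eta_m+g_k^n\eta_0=0\qquad\forall\,\eta=(\eta_0,\dots,\eta_m)\in\mathbb{R}^{m+1}.$$ *)

theory Defs
  imports "HOL-Probability.Essential_Supremum"
begin

section \<open>Function spaces\<close>

definition L2_on :: "real \<Rightarrow> real \<Rightarrow> (real \<Rightarrow> real) set" where
  "L2_on a b = {g. g \<in> borel_measurable (lebesgue_on {a<..<b}) \<and>
                   integrable (lebesgue_on {a<..<b}) (\<lambda>x. (g x)\<^sup>2)}"

definition test_function :: "real \<Rightarrow> real \<Rightarrow> (real \<Rightarrow> real) \<Rightarrow> bool" where
  "test_function a b \<phi> \<longleftrightarrow> \<phi> C1_differentiable_on UNIV \<and>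
     (\<exists>c d. a < c \<and> d < b \<and> (\<forall>x. x \<notin> {c..d} \<longrightarrow> \<phi> x = 0))"

definition is_weak_deriv :: "real \<Rightarrow> real \<Rightarrow> (real \<Rightarrow> real) \<Rightarrow> (real \<Rightarrow> real) \<Rightarrow> bool" where
  "is_weak_deriv a b g g' \<longleftrightarrow>
     (\<forall>\<phi>. test_function a b \<phi> \<longrightarrow>
        (LINT x|lebesgue_on {a<..<b}. g x * deriv \<phi> x) =
        - (LINT x|lebesgue_on {a<..<b}. g' x * \<phi> x))"

text \<open>Elements are functions, not equivalence classes; nothing is required of values outside
  the open interval or on null sets.\<close>

definition W21 :: "real \<Rightarrow> real \<Rightarrow> (real \<Rightarrow> real) set" where
  "W21 a b = {g \<in> L2_on a b. \<exists>g' \<in> L2_on a b. is_weak_deriv a b g g'}"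

text \<open>The choice is harmless: weak derivatives are unique up to null sets, and only their
  integrals are used.\<close>

definition weak_deriv :: "real \<Rightarrow> real \<Rightarrow> (real \<Rightarrow> real) \<Rightarrow> real \<Rightarrow> real" where
  "weak_deriv a b g = (SOME g'. g' \<in> L2_on a b \<and> is_weak_deriv a b g g')"

definition W21_norm :: "real \<Rightarrow> real \<Rightarrow> (real \<Rightarrow> real) \<Rightarrow> real" where
  "W21_norm a b g =
     sqrt (LINT x|lebesgue_on {a<..<b}. (g x)\<^sup>2 + (weak_deriv a b g x)\<^sup>2)"

definition Linf_esssup :: "(real \<times> real) set \<Rightarrow> (real \<times> real \<Rightarrow> real) \<Rightarrow> ereal" where
  "Linf_esssup D f = esssup (lebesgue_on D) (\<lambda>z. ereal \<bar>f z\<bar>)"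

definition Linf :: "(real \<times> real) set \<Rightarrow> (real \<times> real \<Rightarrow> real) set" where
  "Linf D = {f. f \<in> borel_measurable (lebesgue_on D) \<and> Linf_esssup D f < \<infinity>}"

definition Linf_norm :: "(real \<times> real) set \<Rightarrow> (real \<times> real \<Rightarrow> real) \<Rightarrow> real" where
  "Linf_norm D f = real_of_ereal (Linf_esssup D f)"

text \<open>Points of the domain are pairs \<open>(x, t)\<close>, space first.\<close>

definition dom_D :: "real \<Rightarrow> real \<Rightarrow> (real \<times> real) set" where
  "dom_D l T = {0<..<l} \<times> {0<..T}"


section \<open>Coefficients\<close>

text \<open>On each closed segment the function coincides, up to the values at the breakpoints, with a
  positive function that is continuously differentiable up to the end points. The library notion
  \<open>C1_differentiable_on\<close> uses two-sided derivatives, so at an end point it refers to some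
  extension of \<open>\<phi>\<close> across it; such an extension exists for every function that is \<open>C\<^sup>1\<close> on the
  closed segment in the one-sided sense.\<close>

definition pos_C1_on_segment :: "real set \<Rightarrow> (real \<Rightarrow> real) \<Rightarrow> bool" where
  "pos_C1_on_segment S w \<longleftrightarrow>
     (\<exists>\<phi>. \<phi> C1_differentiable_on S \<and> (\<forall>x\<in>S. \<phi> x > 0) \<and> (\<forall>x\<in>interior S. w x = \<phi> x))"

definition has_jump_at :: "(real \<Rightarrow> real) \<Rightarrow> real \<Rightarrow> real \<Rightarrow> bool" where
  "has_jump_at w x c \<longleftrightarrow>
     (\<exists>L R. (w \<longlongrightarrow> L) (at_left x) \<and> (w \<longlongrightarrow> R) (at_right x) \<and> R - L = c)"

definition pos_piecewise_C1 :: "nat \<Rightarrow> (nat \<Rightarrow> real) \<Rightarrow> (real \<Rightarrow> real) \<Rightarrow> bool" where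
  "pos_piecewise_C1 J u w \<longleftrightarrow>
     (\<forall>x. w x > 0) \<and>
     pos_C1_on_segment {..u 1} w \<and>
     (\<forall>j\<in>{1..<J}. pos_C1_on_segment {u j..u (j + 1)} w) \<and>
     pos_C1_on_segment {u J..} w \<and>
     (\<forall>j\<in>{1..J}. \<exists>c. c \<noteq> 0 \<and> has_jump_at w (u j) c)"

definition F_of :: "(real \<Rightarrow> real) \<Rightarrow> real \<Rightarrow> real \<Rightarrow> real" where
  "F_of k u1 u = (LBINT y=ereal u1..ereal u. k y)"

text \<open>Meaningful for \<open>v\<close> in the range of \<open>F\<close>.\<close>

definition beta_of :: "(real \<Rightarrow> real) \<Rightarrow> (real \<Rightarrow> real) \<Rightarrow> real \<Rightarrow> real \<Rightarrow> real" where
  "beta_of \<alpha> k u1 v = \<alpha> (inv (F_of k u1) v) / k (inv (F_of k u1) v)"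

definition mollifier_const :: real where
  "mollifier_const = 1 / (LBINT y:{-1<..<1}. exp (- 1 / (1 - y\<^sup>2)))"

definition mollifier :: "nat \<Rightarrow> real \<Rightarrow> real" where
  "mollifier n v = (if \<bar>v\<bar> < 1 / real n
     then mollifier_const * real n * exp (- 1 / (1 - (real n)\<^sup>2 * v\<^sup>2)) else 0)"

definition smoothed :: "(real \<Rightarrow> real) \<Rightarrow> nat \<Rightarrow> real \<Rightarrow> real" where
  "smoothed b n v = (LBINT y:{v - 1 / real n..v + 1 / real n}. b y * mollifier n (v - y))"


section \<open>Discretization\<close>

definition time_step :: "real \<Rightarrow> nat \<Rightarrow> real" where
  "time_step T n = T / real n"

definition space_step :: "real \<Rightarrow> nat \<Rightarrow> real" where
  "space_step l m = l / real m"

definition tgrid :: "real \<Rightarrow> nat \<Rightarrow> nat \<Rightarrow> real" where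
  "tgrid T n k = real k * time_step T n"

definition xgrid :: "real \<Rightarrow> nat \<Rightarrow> nat \<Rightarrow> real" where
  "xgrid l m i = real i * space_step l m"

definition time_avg :: "real \<Rightarrow> nat \<Rightarrow> (real \<Rightarrow> real) \<Rightarrow> nat \<Rightarrow> real" where
  "time_avg T n p k =
     1 / time_step T n * (LINT t:{tgrid T n (k - 1)..tgrid T n k}|lebesgue. p t)"

text \<open>Here the value of \<open>\<Phi>\<close> at \<open>l\<close> is used, so \<open>\<Phi>\<close> has to be the continuous representative.\<close>

definition Phi_disc :: "real \<Rightarrow> nat \<Rightarrow> (real \<Rightarrow> real) \<Rightarrow> nat \<Rightarrow> real" where
  "Phi_disc l m \<Phi> i = (if i < m
     then 1 / space_step l m * (LINT x:{xgrid l m i..xgrid l m (i + 1)}|lebesgue. \<Phi> x)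
     else \<Phi> l)"

definition f_disc ::
  "real \<Rightarrow> real \<Rightarrow> nat \<Rightarrow> nat \<Rightarrow> (real \<times> real \<Rightarrow> real) \<Rightarrow> nat \<Rightarrow> nat \<Rightarrow> real" where
  "f_disc l T m n f i k = 1 / (time_step T n * space_step l m) *
     (LINT z:({xgrid l m i..xgrid l m (i + 1)} \<times> {tgrid T n (k - 1)..tgrid T n k})|lebesgue. f z)"

definition xdiff :: "real \<Rightarrow> (nat \<Rightarrow> real) \<Rightarrow> nat \<Rightarrow> real" where
  "xdiff h w i = (w (i + 1) - w i) / h"

definition tdiff :: "real \<Rightarrow> (nat \<Rightarrow> real) \<Rightarrow> nat \<Rightarrow> real" where
  "tdiff \<tau> w k = (w k - w (k - 1)) / \<tau>"

definition disc_w21_norm :: "real \<Rightarrow> nat \<Rightarrow> (nat \<Rightarrow> real) \<Rightarrow> real" where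
  "disc_w21_norm T n g = sqrt ((\<Sum>k=1..n. time_step T n * (g k)\<^sup>2) +
     (\<Sum>k=1..n. time_step T n * (tdiff (time_step T n) g k)\<^sup>2))"

text \<open>A vector \<open>(g\<^sub>0, \<dots>, g\<^sub>n)\<close> is a function on \<open>nat\<close> of which only the values up to \<open>n\<close> are
  used; likewise for the state vectors and test vectors below.\<close>

definition control_set :: "real \<Rightarrow> real \<Rightarrow> nat \<Rightarrow> (nat \<Rightarrow> real) set" where
  "control_set T R n = {g. disc_w21_norm T n g \<le> R}"

text \<open>At most one summand is nonzero at each \<open>t\<close>.\<close>

definition interpolant :: "real \<Rightarrow> nat \<Rightarrow> (nat \<Rightarrow> real) \<Rightarrow> real \<Rightarrow> real" where
  "interpolant T n g t = (\<Sum>k=1..n. indicator {tgrid T n (k - 1)..<tgrid T n k} t *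
     (g (k - 1) + (g k - g (k - 1)) / time_step T n * (t - tgrid T n (k - 1))))"

text \<open>\<open>v k i\<close> is the value at time level \<open>k\<close> and space node \<open>i\<close>.\<close>

definition discrete_state_vector ::
  "real \<Rightarrow> real \<Rightarrow> (real \<Rightarrow> real) \<Rightarrow> (real \<Rightarrow> real) \<Rightarrow> (real \<Rightarrow> real) \<Rightarrow> (real \<times> real \<Rightarrow> real) \<Rightarrow>
   nat \<Rightarrow> nat \<Rightarrow> (nat \<Rightarrow> real) \<Rightarrow> (nat \<Rightarrow> nat \<Rightarrow> real) \<Rightarrow> bool" where
  "discrete_state_vector l T b p \<Phi> f n m g v \<longleftrightarrow>
     (let \<tau> = time_step T n; h = space_step l m in
       (\<forall>i\<le>m. v 0 i = Phi_disc l m \<Phi> i) \<and>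
       (\<forall>k\<in>{1..n}. \<forall>\<eta> :: nat \<Rightarrow> real.
         (\<Sum>i=0..m-1. h * (tdiff \<tau> (\<lambda>k. smoothed b n (v k i)) k * \<eta> i
                            + xdiff h (v k) i * xdiff h \<eta> i
                            - f_disc l T m n f i k * \<eta> i))
         - time_avg T n p k * \<eta> m
         + time_avg T n (interpolant T n g) k * \<eta> 0 = 0))"

definition energy_norm_sq ::
  "real \<Rightarrow> real \<Rightarrow> nat \<Rightarrow> nat \<Rightarrow> (nat \<Rightarrow> nat \<Rightarrow> real) \<Rightarrow> real" where
  "energy_norm_sq l T n m v =
     (let \<tau> = time_step T n; h = space_step l m in
       (\<Sum>k=1..n. \<tau> * (\<Sum>i=0..m-1. h * (tdiff \<tau> (\<lambda>k. v k i) k)\<^sup>2))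
       + (MAX k\<in>{1..n}. \<Sum>i=0..m-1. h * (xdiff h (v k) i)\<^sup>2)
       + (\<Sum>k=1..n. \<tau>\<^sup>2 * (\<Sum>i=0..m-1. h * (tdiff \<tau> (\<lambda>k. xdiff h (v k) i) k)\<^sup>2)))"

end

theory Submission
  imports Defs
begin

text \<open>
  The estimate is the discrete analogue of multiplying a parabolic equation by the time derivative
  of its solution. Choosing the increment \<open>v k - v (k - 1)\<close> as test vector, the time term dominates
  \<open>bbar\<close> times the squared difference quotient because the smoothed nonlinearity has slope at least
  \<open>bbar\<close>, however steep it is near the jumps of \<open>b\<close>; the space term telescopes and produces the
  other two parts of the energy norm. Only the boundary fluxes are delicate, since they are paired
  with increments of boundary values. Summing by parts in time moves the difference onto the data,
  and a discrete trace inequality bounds the remaining boundary values, uniformly in time, by the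
  energy itself, so that they can be absorbed with a small factor. This is lemma
  \<open>discrete_energy_estimate\<close>; its constant depends on the lengths of the two intervals and on
  \<open>bbar\<close>, and not on the number of grid points.

  What remains is to bound the discrete data by norms of the continuous data. For the source this is
  immediate. For the boundary data one needs bounds for the size and the total variation of their cell
  means, and for the initial data bounds for a discrete Sobolev norm. Besides Cauchy's inequality,
  all of these rest on one fact, \<open>weak_deriv_average_difference\<close>: two means of a Sobolev function over intervals inside
  \<open>{A..B}\<close> differ by at most the integral of the modulus of its weak derivative over \<open>{A..B}\<close>. It
  comes from testing with the difference of two ramps. To apply it to the controls as well, their
  piecewise linear interpolants are shown to be Sobolev functions in \<open>interpolant_in_W21\<close>.
\<close>

section \<open>Smooth ramps\<close>

definition pos_sq :: "real \<Rightarrow> real" where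
  "pos_sq x = (max 0 x)\<^sup>2"

lemma pos_sq_deriv: "(pos_sq has_real_derivative 2 * max 0 x) (at x)"
proof (cases x "0 :: real" rule: linorder_cases)
  case less
  have "((\<lambda>x::real. 0) has_real_derivative 0) (at x)" by simp
  hence "(pos_sq has_real_derivative 0) (at x)"
    by (rule DERIV_cong_ev[OF refl _ refl, THEN iffD1, rotated])
      (use eventually_nhds_in_open[of "{..<0}" x] less in \<open>auto simp: pos_sq_def elim!: eventually_mono\<close>)
  thus ?thesis using less by simp
next
  case greater
  have "((\<lambda>x::real. x\<^sup>2) has_real_derivative 2 * x) (at x)" by (auto intro!: derivative_eq_intros)
  hence "(pos_sq has_real_derivative 2 * x) (at x)"
    by (rule DERIV_cong_ev[OF refl _ refl, THEN iffD1, rotated])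
      (use eventually_nhds_in_open[of "{0<..}" x] greater in \<open>auto simp: pos_sq_def elim!: eventually_mono\<close>)
  thus ?thesis using greater by simp
next
  case equal
  have "((\<lambda>h. pos_sq h / h) \<longlongrightarrow> 0) (at 0)"
  proof (rule Lim_null_comparison)
    show "\<forall>\<^sub>F h in at 0. norm (pos_sq h / h) \<le> \<bar>h\<bar>"
      by (intro always_eventually) (auto simp: pos_sq_def max_def power2_eq_square)
    show "((\<lambda>h::real. \<bar>h\<bar>) \<longlongrightarrow> 0) (at 0)" using tendsto_rabs_zero[OF tendsto_ident_at] by simp
  qed
  thus ?thesis using equal by (simp add: DERIV_def pos_sq_def)
qed

text \<open>A \<open>C\<^sup>1\<close> approximation of the function \<open>max 0 (min 1 x)\<close>, written so that its derivative is an
  explicit continuous trapezoid. The shifts by \<open>e\<close> and \<open>2 * e\<close> keep the support of the derivative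
  strictly inside the unit interval, and \<open>1 - 3 * e\<close> is the total increment before normalization.\<close>

definition smooth_ramp :: "real \<Rightarrow> real \<Rightarrow> real" where
  "smooth_ramp e x = (pos_sq (x - e) - pos_sq (x - 2 * e) - pos_sq (x - (1 - 2 * e)) + pos_sq (x - (1 - e)))
     / (2 * e * (1 - 3 * e))"

definition smooth_ramp_deriv :: "real \<Rightarrow> real \<Rightarrow> real" where
  "smooth_ramp_deriv e x = (max 0 (x - e) - max 0 (x - 2 * e) - max 0 (x - (1 - 2 * e)) + max 0 (x - (1 - e)))
     / (e * (1 - 3 * e))"

lemma smooth_ramp_has_deriv:
  "(smooth_ramp e has_real_derivative smooth_ramp_deriv e x) (at x)"
proof -
  have *: "((\<lambda>x. pos_sq (x - c)) has_real_derivative 2 * max 0 (x - c)) (at x)" for c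
  proof -
    have "((\<lambda>x. x - c) has_real_derivative 1) (at x)" by (auto intro!: derivative_eq_intros)
    from DERIV_chain2[OF pos_sq_deriv this] show ?thesis by simp
  qed
  let ?N = "max 0 (x - e) - max 0 (x - 2 * e) - max 0 (x - (1 - 2 * e)) + max 0 (x - (1 - e))"
  have "((\<lambda>x. pos_sq (x - e) - pos_sq (x - 2 * e) - pos_sq (x - (1 - 2 * e)) + pos_sq (x - (1 - e)))
      has_real_derivative 2 * max 0 (x - e) - 2 * max 0 (x - 2 * e) - 2 * max 0 (x - (1 - 2 * e))
        + 2 * max 0 (x - (1 - e))) (at x)"
    by (intro DERIV_add DERIV_diff *)
  also have "2 * max 0 (x - e) - 2 * max 0 (x - 2 * e) - 2 * max 0 (x - (1 - 2 * e))
        + 2 * max 0 (x - (1 - e)) = 2 * ?N" by simp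
  finally show ?thesis
    using DERIV_cdivide[of _ "2 * ?N" x UNIV "2 * (e * (1 - 3 * e))"]
    unfolding smooth_ramp_def[abs_def] smooth_ramp_deriv_def mult.assoc
      mult_divide_mult_cancel_left_if[of 2] by simp
qed

lemma continuous_smooth_ramp_deriv: "continuous_on UNIV (smooth_ramp_deriv e)"
  unfolding smooth_ramp_deriv_def[abs_def] divide_inverse by (intro continuous_intros)

lemma smooth_ramp_0: "0 < e \<Longrightarrow> e \<le> 1/6 \<Longrightarrow> x \<le> e \<Longrightarrow> smooth_ramp e x = 0"
  by (simp add: smooth_ramp_def pos_sq_def)

lemma smooth_ramp_1: "0 < e \<Longrightarrow> e \<le> 1/6 \<Longrightarrow> x \<ge> 1 - e \<Longrightarrow> smooth_ramp e x = 1"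
  by (simp add: smooth_ramp_def pos_sq_def) (simp add: divide_simps power2_eq_square algebra_simps)

lemma smooth_ramp_deriv_bounds:
  assumes "0 < e" "e \<le> 1/6"
  shows "smooth_ramp_deriv e x \<ge> 0" "smooth_ramp_deriv e x \<le> 2"
proof -
  let ?N = "max 0 (x - e) - max 0 (x - 2 * e) - max 0 (x - (1 - 2 * e)) + max 0 (x - (1 - e))"
  have "?N \<ge> 0" "?N \<le> e" using assms by (auto simp: max_def)
  moreover have "e * (1 / 2) \<le> e * (1 - 3 * e)" using assms by (intro mult_left_mono) auto
  ultimately have "?N \<le> 2 * (e * (1 - 3 * e))" by linarith
  with \<open>?N \<ge> 0\<close> show "smooth_ramp_deriv e x \<ge> 0" "smooth_ramp_deriv e x \<le> 2"
    using assms by (auto simp: smooth_ramp_deriv_def pos_divide_le_eq)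
qed

text \<open>The ramp is monotone because its derivative is nonnegative, and it is constant outside the unit
  interval.\<close>

lemma smooth_ramp_bounds:
  assumes "0 < e" "e \<le> 1/6"
  shows "smooth_ramp e x \<ge> 0" "smooth_ramp e x \<le> 1"
proof -
  have mono: "smooth_ramp e x \<le> smooth_ramp e y" if "x \<le> y" for x y
    by (rule DERIV_nonneg_imp_nondecreasing[OF that])
      (use smooth_ramp_has_deriv smooth_ramp_deriv_bounds[OF assms] in blast)
  show "smooth_ramp e x \<ge> 0" "smooth_ramp e x \<le> 1"
    using mono[of "min x 0" x] mono[of x "max x 1"] smooth_ramp_0[OF assms, of "min x 0"]
      smooth_ramp_1[OF assms, of "max x 1"] assms by auto
qed

text \<open>Convergence holds at every point, the two ends included, because the trapezoid vanishes there
  for all admissible \<open>e\<close>.\<close>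

lemma smooth_ramp_deriv_tendsto:
  assumes e: "e \<longlonglongrightarrow> 0" "\<And>n. 0 < e n" "\<And>n. e n \<le> 1/6"
  shows "(\<lambda>n. smooth_ramp_deriv (e n) x) \<longlonglongrightarrow> indicator {0<..<1} x"
proof (cases "0 < x \<and> x < 1")
  case True
  have "\<forall>\<^sub>F n in sequentially. e n < min (x / 2) ((1 - x) / 2)"
    using True by (intro order_tendstoD[OF e(1)]) auto
  hence "\<forall>\<^sub>F n in sequentially. 1 / (1 - 3 * e n) = smooth_ramp_deriv (e n) x"
  proof eventually_elim
    case (elim n)
    thus ?case using e(2)[of n] by (simp add: smooth_ramp_deriv_def max_def)
  qed
  moreover have "(\<lambda>n. 1 / (1 - 3 * e n)) \<longlonglongrightarrow> 1 / (1 - 3 * 0)"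
    by (intro tendsto_intros e) auto
  ultimately show ?thesis using True by (simp add: Lim_transform_eventually)
next
  case False
  have "smooth_ramp_deriv (e n) x = 0" for n
    using False e(2)[of n] e(3)[of n] by (auto simp: smooth_ramp_deriv_def max_def)
  thus ?thesis using False by simp
qed

section \<open>Means of Sobolev functions\<close>

text \<open>The interval has finite length, so \<open>\<bar>g\<bar> \<le> 1 + g\<^sup>2\<close> makes square integrable functions integrable. Passing
  to the closed interval only adds a null set.\<close>

lemma L2_on_absolutely_integrable:
  assumes "g \<in> L2_on a b"
  shows "g absolutely_integrable_on {a..b}" "(\<lambda>x. (g x)\<^sup>2) absolutely_integrable_on {a..b}"
proof -
  let ?M = "lebesgue_on {a<..<b}"
  have m: "g \<in> borel_measurable ?M" and i: "integrable ?M (\<lambda>x. (g x)\<^sup>2)"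
    using assms by (auto simp: L2_on_def)
  have "finite_measure ?M" by (rule finite_measure_lebesgue_on) auto
  then interpret finite_measure ?M .
  have "integrable ?M (\<lambda>x. 1 + (g x)\<^sup>2)" using i by auto
  hence "integrable ?M g"
  proof (rule Bochner_Integration.integrable_bound[OF _ m], intro AE_I2)
    fix x show "norm (g x) \<le> norm (1 + (g x)\<^sup>2)"
      using zero_le_power2[of "\<bar>g x\<bar> - 1"] by (simp add: power2_diff)
  qed
  thus "g absolutely_integrable_on {a..b}"
    unfolding absolutely_integrable_on_Icc_iff_Ioo unfolding set_integrable_def
    by (subst (asm) integrable_restrict_space) auto
  show "(\<lambda>x. (g x)\<^sup>2) absolutely_integrable_on {a..b}"
    using i unfolding absolutely_integrable_on_Icc_iff_Ioo unfolding set_integrable_def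
    by (subst (asm) integrable_restrict_space) auto
qed

lemma LINT_Ioo_eq_integral:
  fixes f :: "real \<Rightarrow> real"
  assumes "f absolutely_integrable_on {a..b}"
  shows "(LINT x|lebesgue_on {a<..<b}. f x) = integral {a..b} f"
proof -
  have "f absolutely_integrable_on {a<..<b}" using assms by (simp add: absolutely_integrable_on_Icc_iff_Ioo)
  hence "(LINT x|lebesgue_on {a<..<b}. f x) = integral {a<..<b} f"
    by (intro lebesgue_integral_eq_integral absolutely_integrable_imp_integrable) auto
  thus ?thesis by (simp add: integral_open_interval_real)
qed

definition ramp_between :: "real \<Rightarrow> real \<Rightarrow> real \<Rightarrow> real \<Rightarrow> real" where
  "ramp_between e c d x = smooth_ramp e ((x - c) / (d - c))"

lemma ramp_between_deriv:
  "c < d \<Longrightarrow> (ramp_between e c d has_real_derivative smooth_ramp_deriv e ((x - c) / (d - c)) / (d - c)) (at x)"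
proof -
  assume "c < d"
  have "((\<lambda>x. (x - c) / (d - c)) has_real_derivative 1 / (d - c)) (at x)"
    using \<open>c < d\<close> by (auto intro!: derivative_eq_intros)
  from DERIV_chain2[OF smooth_ramp_has_deriv this, of e] show ?thesis
    by (simp add: ramp_between_def[abs_def])
qed

lemma integral_mult_average:
  fixes g :: "real \<Rightarrow> real"
  assumes g: "g absolutely_integrable_on {a..b}" and "a \<le> c" "c < d" "d \<le> b"
  shows "integrable (lebesgue_on {a<..<b}) (\<lambda>x. g x * (indicator {c<..<d} x / (d - c)))"
    and "(LINT x|lebesgue_on {a<..<b}. g x * (indicator {c<..<d} x / (d - c))) = integral {c..d} g / (d - c)"
proof -
  have gcd: "g absolutely_integrable_on {c<..<d}"
    using absolutely_integrable_on_subinterval[OF g, of c d] assms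
    by (simp add: absolutely_integrable_on_Icc_iff_Ioo)
  have eq: "indicator {a<..<b} x *\<^sub>R (g x * indicator {c<..<d} x) = indicator {c<..<d} x *\<^sub>R g x" for x
    using assms by (auto simp: indicator_def)
  have "integrable (lebesgue_on {a<..<b}) (\<lambda>x. g x * indicator {c<..<d} x)"
    using gcd unfolding set_integrable_def by (subst integrable_restrict_space) (auto simp only: eq, auto)
  thus "integrable (lebesgue_on {a<..<b}) (\<lambda>x. g x * (indicator {c<..<d} x / (d - c)))"
    using integrable_divide[of "lebesgue_on {a<..<b}" "\<lambda>x. g x * indicator {c<..<d} x" "d - c"] by simp
  have "(LINT x|lebesgue_on {a<..<b}. g x * indicator {c<..<d} x) = (LINT x:{c<..<d}|lebesgue. g x)"
    unfolding set_lebesgue_integral_def by (subst integral_restrict_space) (auto simp only: eq, auto)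
  also have "\<dots> = integral {c..d} g"
    using set_lebesgue_integral_eq_integral(2)[OF gcd] by (simp add: integral_open_interval_real)
  finally have "(LINT x|lebesgue_on {a<..<b}. g x * indicator {c<..<d} x) = integral {c..d} g" .
  thus "(LINT x|lebesgue_on {a<..<b}. g x * (indicator {c<..<d} x / (d - c))) = integral {c..d} g / (d - c)"
    using integral_divide_zero[of "lebesgue_on {a<..<b}" "\<lambda>x. g x * indicator {c<..<d} x" "d - c"] by simp
qed

text \<open>A bound on the oscillation of means that uses only the defining identity of the weak derivative, so
  that no continuous representative has to be constructed. The difference of the two means is
  \<open>\<integral> g \<psi>\<close>, where \<open>\<psi>\<close> is the difference of the normalized indicators of the two intervals. Its
  primitive \<open>\<phi>\<close> is a difference of two ramps: it has modulus at most one, and it vanishes outside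
  \<open>{A..B}\<close>, since on the left both ramps are zero and on the right both are one. Formally
  \<open>\<integral> g \<psi> = - \<integral> g' \<phi>\<close>, which gives the claim. As \<open>\<phi>\<close> is only Lipschitz, smooth ramps
  replace the sharp ones; dominated convergence is needed on the side of \<open>g\<close> only, because the bound
  on the side of \<open>g'\<close> is the same for every approximation.\<close>

lemma weak_deriv_average_difference:
  assumes g: "g \<in> L2_on a b" and g': "g' \<in> L2_on a b" and weak: "is_weak_deriv a b g g'"
    and A: "a \<le> A" "B \<le> b" and cd: "A \<le> c" "c < d" "d \<le> B" and cd': "A \<le> c'" "c' < d'" "d' \<le> B"
  shows "\<bar>integral {c..d} g / (d - c) - integral {c'..d'} g / (d' - c')\<bar> \<le> integral {A..B} (\<lambda>x. \<bar>g' x\<bar>)"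
proof -
  let ?M = "lebesgue_on {a<..<b}"
  note gi = L2_on_absolutely_integrable(1)[OF g] and gi' = L2_on_absolutely_integrable(1)[OF g']
  define e :: "nat \<Rightarrow> real" where "e n = 1 / (real n + 6)" for n
  have e: "0 < e n" "e n \<le> 1 / 6" for n by (auto simp: e_def divide_simps)
  have e0: "e \<longlonglongrightarrow> 0" unfolding e_def using LIMSEQ_ignore_initial_segment[OF lim_1_over_n, of 6] by simp
  define \<phi> where "\<phi> n x = ramp_between (e n) c d x - ramp_between (e n) c' d' x" for n x
  define \<psi> where "\<psi> n x = smooth_ramp_deriv (e n) ((x - c) / (d - c)) / (d - c)
      - smooth_ramp_deriv (e n) ((x - c') / (d' - c')) / (d' - c')" for n x
  have deriv: "(\<phi> n has_real_derivative \<psi> n x) (at x)" for n x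
    unfolding \<phi>_def[abs_def] \<psi>_def using cd cd' by (intro DERIV_diff ramp_between_deriv) auto
  have cont: "continuous_on UNIV (\<psi> n)" for n
    unfolding \<psi>_def[abs_def] divide_inverse
    by (intro continuous_intros continuous_on_compose2[OF continuous_smooth_ramp_deriv]) auto
  have ramp: "0 \<le> ramp_between (e n) c d x" "ramp_between (e n) c d x \<le> 1" for n c d x
    using smooth_ramp_bounds[OF e] by (auto simp: ramp_between_def)
  have ramp0: "ramp_between (e n) c d x = 0" if "c < d" "x \<le> c + e n * (d - c)" for n c d x
    unfolding ramp_between_def using that by (intro smooth_ramp_0 e) (simp add: field_simps)
  have ramp1: "ramp_between (e n) c d x = 1" if "c < d" "x \<ge> d - e n * (d - c)" for n c d x
    unfolding ramp_between_def using that by (intro smooth_ramp_1 e) (simp add: field_simps)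
  have epos: "e n * (d - c) > 0" "e n * (d' - c') > 0" for n using e(1)[of n] cd cd' by auto
  \<comment> \<open>The smooth ramps are constant near the ends of their intervals, which leaves room for a compact
      support inside the open interval even when the intervals reach \<open>a\<close> or \<open>b\<close>.\<close>
  have test: "test_function a b (\<phi> n)" for n
    unfolding test_function_def
  proof (intro conjI exI allI impI)
    show "\<phi> n C1_differentiable_on UNIV"
      unfolding C1_differentiable_on_def
      using deriv cont by (auto simp: has_real_derivative_iff_has_vector_derivative)
    let ?c = "min (c + e n * (d - c)) (c' + e n * (d' - c'))"
    let ?d = "max (d - e n * (d - c)) (d' - e n * (d' - c'))"
    show "a < ?c" "?d < b" using epos[of n] A cd cd' by auto
    fix x assume "x \<notin> {?c..?d}"
    hence "x < ?c \<or> x > ?d" by (auto simp del: min_less_iff_conj max_less_iff_conj)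
    thus "\<phi> n x = 0"
      using ramp0[of c d x n] ramp0[of c' d' x n] ramp1[of c d n x] ramp1[of c' d' n x] cd cd'
      by (auto simp: \<phi>_def)
  qed
  have \<phi>_bound: "\<bar>g' x * \<phi> n x\<bar> \<le> indicator {A..B} x * \<bar>g' x\<bar>" for n x
  proof (cases "x \<in> {A..B}")
    case True
    have "\<bar>\<phi> n x\<bar> \<le> 1" using ramp[of n c d x] ramp[of n c' d' x] unfolding \<phi>_def by linarith
    thus ?thesis using True mult_left_mono[of "\<bar>\<phi> n x\<bar>" 1 "\<bar>g' x\<bar>"] by (simp add: abs_mult)
  next
    case False
    hence "x \<le> c + e n * (d - c) \<and> x \<le> c' + e n * (d' - c') \<or> x \<ge> d - e n * (d - c) \<and> x \<ge> d' - e n * (d' - c')"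
      using cd cd' epos[of n] by auto
    hence "\<phi> n x = 0"
      using ramp0[of c d x n] ramp0[of c' d' x n] ramp1[of c d n x] ramp1[of c' d' n x] cd cd'
      by (auto simp: \<phi>_def)
    thus ?thesis by simp
  qed
  have gM: "integrable ?M g" and gM': "integrable ?M g'"
    using gi gi' unfolding absolutely_integrable_on_Icc_iff_Ioo
    by (auto intro: absolutely_integrable_imp_integrable)
  have mM: "h \<in> borel_measurable ?M" if "continuous_on UNIV h" for h :: "real \<Rightarrow> real"
    using borel_measurable_continuous_onI[OF that]
    by (intro measurable_restrict_space1 measurable_completion) simp
  have lim: "(\<lambda>n. LINT x|?M. g x * \<psi> n x) \<longlonglongrightarrow>
      (LINT x|?M. g x * (indicator {c<..<d} x / (d - c)) - g x * (indicator {c'<..<d'} x / (d' - c')))"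
  proof (rule integral_dominated_convergence)
    show "integrable ?M (\<lambda>x. \<bar>g x\<bar> * (2 / (d - c) + 2 / (d' - c')))"
      using gM by auto
    show "(\<lambda>x. g x * (indicator {c<..<d} x / (d - c)) - g x * (indicator {c'<..<d'} x / (d' - c'))) \<in> borel_measurable ?M"
      using integral_mult_average(1)[OF gi, of c d] integral_mult_average(1)[OF gi, of c' d'] A cd cd'
      by (intro borel_measurable_diff borel_measurable_integrable) auto
    show "(\<lambda>x. g x * \<psi> n x) \<in> borel_measurable ?M" for n
      using gM mM[OF cont] by auto
    show "AE x in ?M. (\<lambda>n. g x * \<psi> n x) \<longlonglongrightarrow>
        g x * (indicator {c<..<d} x / (d - c)) - g x * (indicator {c'<..<d'} x / (d' - c'))"
    proof (intro AE_I2)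
      fix x :: real
      have ind: "indicator {c<..<d} x = (indicator {0<..<1} ((x - c) / (d - c)) :: real)" if "c < d" for c d
        using that by (auto simp: indicator_def zero_less_divide_iff pos_divide_less_eq)
      show "(\<lambda>n. g x * \<psi> n x) \<longlonglongrightarrow>
        g x * (indicator {c<..<d} x / (d - c)) - g x * (indicator {c'<..<d'} x / (d' - c'))"
        unfolding \<psi>_def ind[OF cd(2)] ind[OF cd'(2)] right_diff_distrib[symmetric]
        using cd cd' by (intro tendsto_intros smooth_ramp_deriv_tendsto e0 e) auto
    qed
    show "AE x in ?M. norm (g x * \<psi> n x) \<le> \<bar>g x\<bar> * (2 / (d - c) + 2 / (d' - c'))" for n
    proof (intro AE_I2)
      fix x
      have b: "0 \<le> smooth_ramp_deriv (e n) y / (d - c)" "smooth_ramp_deriv (e n) y / (d - c) \<le> 2 / (d - c)"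
        if "c < d" for y c d
        using smooth_ramp_deriv_bounds[OF e, of n y] that by (auto intro: divide_right_mono)
      have "\<bar>\<psi> n x\<bar> \<le> 2 / (d - c) + 2 / (d' - c')"
        using b[OF cd(2), of "(x - c) / (d - c)"] b[OF cd'(2), of "(x - c') / (d' - c')"]
        unfolding \<psi>_def by linarith
      thus "norm (g x * \<psi> n x) \<le> \<bar>g x\<bar> * (2 / (d - c) + 2 / (d' - c'))"
        by (simp add: abs_mult mult_left_mono)
    qed
  qed
  have "(LINT x|?M. g x * (indicator {c<..<d} x / (d - c)) - g x * (indicator {c'<..<d'} x / (d' - c')))
      = integral {c..d} g / (d - c) - integral {c'..d'} g / (d' - c')"
    using integral_mult_average[OF gi, of c d] integral_mult_average[OF gi, of c' d'] A cd cd' by simp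
  with lim have lim': "(\<lambda>n. LINT x|?M. g x * \<psi> n x) \<longlonglongrightarrow> integral {c..d} g / (d - c) - integral {c'..d'} g / (d' - c')"
    by simp
  have i: "integrable ?M (\<lambda>x. indicator {A..B} x * \<bar>g' x\<bar>)"
  proof (rule Bochner_Integration.integrable_bound[OF integrable_abs[OF gM']])
    have "(indicator {A..B} :: real \<Rightarrow> real) \<in> borel_measurable ?M"
      by (intro measurable_restrict_space1 measurable_completion) simp
    thus "(\<lambda>x. indicator {A..B} x * \<bar>g' x\<bar>) \<in> borel_measurable ?M" using gM' by auto
  qed (auto simp: indicator_def)
  have "\<bar>LINT x|?M. g x * \<psi> n x\<bar> \<le> integral {A..B} (\<lambda>x. \<bar>g' x\<bar>)" for n
  proof -
    have "deriv (\<phi> n) = \<psi> n" using deriv by (auto intro!: DERIV_imp_deriv)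
    hence "\<bar>LINT x|?M. g x * \<psi> n x\<bar> = \<bar>LINT x|?M. g' x * \<phi> n x\<bar>"
      using weak test[of n] unfolding is_weak_deriv_def by auto
    also have "\<dots> \<le> (LINT x|?M. \<bar>g' x * \<phi> n x\<bar>)" by (rule integral_abs_bound)
    also have "\<dots> \<le> (LINT x|?M. indicator {A..B} x * \<bar>g' x\<bar>)"
    proof (rule integral_mono)
      show "integrable ?M (\<lambda>x. indicator {A..B} x * \<bar>g' x\<bar>)" by fact
      have "continuous_on UNIV (\<phi> n)"
        using deriv by (meson DERIV_isCont continuous_at_imp_continuous_on)
      thus "integrable ?M (\<lambda>x. \<bar>g' x * \<phi> n x\<bar>)"
        using gM' mM \<phi>_bound[of _ n]
        by (intro Bochner_Integration.integrable_bound[OF i]) (auto simp: abs_mult)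
    qed (rule \<phi>_bound)
    also have "\<dots> = integral {a<..<b} (\<lambda>x. indicator {A..B} x * \<bar>g' x\<bar>)"
      by (rule lebesgue_integral_eq_integral[OF i]) simp
    also have "\<dots> = integral {a..b} (\<lambda>x. if x \<in> {A..B} then \<bar>g' x\<bar> else 0)"
      unfolding integral_open_interval_real by (intro integral_cong) auto
    also have "\<dots> = integral {A..B} (\<lambda>x. \<bar>g' x\<bar>)"
      unfolding integral_restrict_Int using A by (simp add: Int_absorb1)
    finally show ?thesis .
  qed
  thus ?thesis
    by (intro LIMSEQ_le_const2[OF tendsto_rabs[OF lim']]) auto
qed

lemma W21_weak_deriv:
  assumes "g \<in> W21 a b"
  shows "weak_deriv a b g \<in> L2_on a b" "is_weak_deriv a b g (weak_deriv a b g)"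
proof -
  have "\<exists>g'. g' \<in> L2_on a b \<and> is_weak_deriv a b g g'" using assms by (auto simp: W21_def)
  from someI_ex[OF this] show "weak_deriv a b g \<in> L2_on a b" "is_weak_deriv a b g (weak_deriv a b g)"
    by (auto simp: weak_deriv_def)
qed

lemma W21_absolutely_integrable:
  assumes "g \<in> W21 a b"
  shows "g absolutely_integrable_on {a..b}" "(\<lambda>x. (g x)\<^sup>2) absolutely_integrable_on {a..b}"
    "weak_deriv a b g absolutely_integrable_on {a..b}"
    "(\<lambda>x. (weak_deriv a b g x)\<^sup>2) absolutely_integrable_on {a..b}"
  using assms L2_on_absolutely_integrable W21_weak_deriv(1) by (auto simp: W21_def)

lemma W21_norm_power2:
  assumes "g \<in> W21 a b"
  shows "(W21_norm a b g)\<^sup>2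
    = integral {a..b} (\<lambda>x. (g x)\<^sup>2) + integral {a..b} (\<lambda>x. (weak_deriv a b g x)\<^sup>2)"
proof -
  note i = W21_absolutely_integrable[OF assms]
  have "(W21_norm a b g)\<^sup>2 = (LINT x|lebesgue_on {a<..<b}. (g x)\<^sup>2 + (weak_deriv a b g x)\<^sup>2)"
    unfolding W21_norm_def by (intro real_sqrt_pow2 integral_nonneg_AE) auto
  also have "\<dots> = integral {a..b} (\<lambda>x. (g x)\<^sup>2 + (weak_deriv a b g x)\<^sup>2)"
    by (intro LINT_Ioo_eq_integral set_integral_add i)
  also have "\<dots> = integral {a..b} (\<lambda>x. (g x)\<^sup>2) + integral {a..b} (\<lambda>x. (weak_deriv a b g x)\<^sup>2)"
    using i by (intro integral_add) (auto intro: set_lebesgue_integral_eq_integral(1))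
  finally show ?thesis .
qed

lemma W21_norm_nonneg: "W21_norm a b g \<ge> 0"
  unfolding W21_norm_def by (intro real_sqrt_ge_zero integral_nonneg_AE) auto

text \<open>Cauchy's inequality against the constant function: the variance of \<open>f\<close> about its mean \<open>c\<close> is
  nonnegative.\<close>

lemma integral_power2_le:
  fixes f :: "real \<Rightarrow> real"
  assumes "A \<le> B" and f: "f integrable_on {A..B}" and f2: "(\<lambda>x. (f x)\<^sup>2) integrable_on {A..B}"
  shows "(integral {A..B} f)\<^sup>2 \<le> (B - A) * integral {A..B} (\<lambda>x. (f x)\<^sup>2)"
proof (cases "A = B")
  case False
  hence L: "B - A > 0" using assms by simp
  define c where "c = integral {A..B} f / (B - A)"
  have "((\<lambda>x. (f x)\<^sup>2 - 2 * c * f x + c\<^sup>2) has_integral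
      (integral {A..B} (\<lambda>x. (f x)\<^sup>2) - 2 * c * integral {A..B} f + c\<^sup>2 * (B - A))) {A..B}"
    using has_integral_const_real[of "c\<^sup>2" A B] assms(1)
    by (intro has_integral_add has_integral_diff has_integral_mult_right integrable_integral f f2)
      (simp add: mult.commute)
  hence "0 \<le> integral {A..B} (\<lambda>x. (f x)\<^sup>2) - 2 * c * integral {A..B} f + c\<^sup>2 * (B - A)"
    by (rule has_integral_nonneg) (smt (verit) power2_diff mult.commute mult.assoc zero_le_power2)
  also have "\<dots> = integral {A..B} (\<lambda>x. (f x)\<^sup>2) - (integral {A..B} f)\<^sup>2 / (B - A)"
    using L by (simp add: c_def power2_eq_square)
  finally show ?thesis using L by (simp add: pos_divide_le_eq mult.commute)
qed auto

lemma sum_adjacent_integrals: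
  fixes w :: "real \<Rightarrow> real"
  assumes h: "h \<ge> 0" and w: "w integrable_on {0..L}" and N: "real N * h \<le> L"
  shows "(\<Sum>i<N. integral {real i * h..real (Suc i) * h} w) = integral {0..real N * h} w"
  using N
proof (induction N)
  case (Suc N)
  have "real N * h \<le> real (Suc N) * h" using h by (intro mult_right_mono) auto
  moreover have "w integrable_on {0..real (Suc N) * h}"
    using Suc.prems by (intro integrable_on_subinterval[OF w]) auto
  ultimately show ?case
    using Henstock_Kurzweil_Integration.integral_combine[of 0 "real N * h" "real (Suc N) * h" w] Suc h
    by auto
qed auto

text \<open>Each cell is covered by at most two of the windows.\<close>

lemma sum_overlapping_integrals_le:
  fixes w :: "real \<Rightarrow> real"
  assumes h: "h \<ge> 0" and w: "w integrable_on {0..L}" and N: "real (Suc N) * h \<le> L"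
    and w0: "\<And>x. w x \<ge> 0"
  shows "(\<Sum>i<N. integral {real i * h..real (Suc (Suc i)) * h} w) \<le> 2 * integral {0..L} w"
proof -
  define I where "I i = integral {real i * h..real (Suc i) * h} w" for i
  have le: "real i * h \<le> real j * h" if "i \<le> j" for i j using that h by (intro mult_right_mono) auto
  have eq: "integral {real i * h..real (Suc (Suc i)) * h} w = I i + I (Suc i)" if "i < N" for i
  proof -
    have "w integrable_on {real i * h..real (Suc (Suc i)) * h}"
      using le[of "Suc (Suc i)" "Suc N"] that N h by (intro integrable_on_subinterval[OF w]) auto
    thus ?thesis
      unfolding I_def
      using Henstock_Kurzweil_Integration.integral_combine[OF le[of i "Suc i"] le[of "Suc i" "Suc (Suc i)"], of w]
      by auto
  qed
  have I0: "I i \<ge> 0" if "i \<le> N" for i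
    unfolding I_def using le[of "Suc i" "Suc N"] that N h w0
    by (intro integral_nonneg integrable_on_subinterval[OF w]) auto
  have "(\<Sum>i<N. integral {real i * h..real (Suc (Suc i)) * h} w) = (\<Sum>i<N. I i) + (\<Sum>i<N. I (Suc i))"
    using eq by (simp add: sum.distrib)
  also have "\<dots> \<le> (\<Sum>i<Suc N. I i) + (\<Sum>i<Suc N. I i)"
    using I0[of 0, simplified] I0[of N, simplified] sum.lessThan_Suc[of I N] sum.lessThan_Suc_shift[of I N] by linarith
  also have "\<dots> = 2 * integral {0..real (Suc N) * h} w"
    unfolding I_def using sum_adjacent_integrals[OF h w N] by simp
  also have "integral {0..real (Suc N) * h} w \<le> integral {0..L} w"
    using w0 N by (intro integral_subset_le integrable_on_subinterval[OF w]) (auto intro: w)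
  finally show ?thesis by simp
qed

lemma time_avg_eq_integral:
  assumes "T > 0" "q absolutely_integrable_on {0..T}" "k \<in> {1..n}"
  shows "time_avg T n q k
    = integral {tgrid T n (k - 1)..tgrid T n k} q / (tgrid T n k - tgrid T n (k - 1))"
proof -
  have d: "tgrid T n k - tgrid T n (k - 1) = time_step T n"
    using assms by (simp add: tgrid_def of_nat_diff algebra_simps)
  have "real k * time_step T n \<le> real n * time_step T n"
    using assms by (intro mult_right_mono) (auto simp: time_step_def)
  hence "q absolutely_integrable_on {tgrid T n (k - 1)..tgrid T n k}"
    using assms by (intro absolutely_integrable_on_subinterval[OF assms(2)]) (auto simp: tgrid_def time_step_def)
  from set_lebesgue_integral_eq_integral(2)[OF this] show ?thesis
    unfolding d time_avg_def by simp
qed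

lemma W21_integral_abs_le:
  assumes "a \<le> b" "g \<in> W21 a b"
  shows "\<bar>integral {a..b} g\<bar> \<le> sqrt (b - a) * W21_norm a b g"
    and "integral {a..b} (\<lambda>x. \<bar>weak_deriv a b g x\<bar>) \<le> sqrt (b - a) * W21_norm a b g"
proof -
  note i = W21_absolutely_integrable[OF assms(2)]
  note i' = i[THEN set_lebesgue_integral_eq_integral(1)]
  have n: "(sqrt (b - a) * W21_norm a b g)\<^sup>2
      = (b - a) * (integral {a..b} (\<lambda>x. (g x)\<^sup>2) + integral {a..b} (\<lambda>x. (weak_deriv a b g x)\<^sup>2))"
    using assms by (simp add: power_mult_distrib W21_norm_power2)
  have nn: "integral {a..b} (\<lambda>x. (g x)\<^sup>2) \<ge> 0" "integral {a..b} (\<lambda>x. (weak_deriv a b g x)\<^sup>2) \<ge> 0"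
    using i' by (auto intro: integral_nonneg)
  have pos: "sqrt (b - a) * W21_norm a b g \<ge> 0" using assms W21_norm_nonneg by simp
  have "(integral {a..b} g)\<^sup>2 \<le> (sqrt (b - a) * W21_norm a b g)\<^sup>2"
    unfolding n using nn assms
    by (intro order_trans[OF integral_power2_le[OF assms(1) i'(1,2)]] mult_left_mono) auto
  thus "\<bar>integral {a..b} g\<bar> \<le> sqrt (b - a) * W21_norm a b g"
    using pos by (metis abs_le_square_iff abs_of_nonneg)
  have "(\<lambda>x. \<bar>weak_deriv a b g x\<bar>) integrable_on {a..b}"
    using i(3) unfolding absolutely_integrable_on_def by simp
  hence "(integral {a..b} (\<lambda>x. \<bar>weak_deriv a b g x\<bar>))\<^sup>2
      \<le> (b - a) * integral {a..b} (\<lambda>x. (weak_deriv a b g x)\<^sup>2)"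
    using integral_power2_le[OF assms(1), of "\<lambda>x. \<bar>weak_deriv a b g x\<bar>"] i'(4) by simp
  also have "\<dots> \<le> (sqrt (b - a) * W21_norm a b g)\<^sup>2"
    unfolding n using nn assms by (intro mult_left_mono) auto
  finally show "integral {a..b} (\<lambda>x. \<bar>weak_deriv a b g x\<bar>) \<le> sqrt (b - a) * W21_norm a b g"
    using pos by (rule power2_le_imp_le)
qed

text \<open>The discrete data enter the energy estimate through summation by parts in time, where exactly this
  combination of end values and total variation occurs. Single means are compared with the mean over
  the whole interval, consecutive ones with each other; the windows of two adjacent cells overlap at
  most twice.\<close>

lemma time_avg_variation_le:
  assumes T: "T > 0" and q: "q \<in> W21 0 T" and N: "N \<in> {1..n}"
  shows "\<bar>time_avg T n q N\<bar> + \<bar>time_avg T n q 1\<bar> + (\<Sum>k=1..<N. \<bar>time_avg T n q (Suc k) - time_avg T n q k\<bar>)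
    \<le> (2 / sqrt T + 4 * sqrt T) * W21_norm 0 T q"
proof -
  define q' where "q' = weak_deriv 0 T q"
  define \<tau> where "\<tau> = time_step T n"
  have \<tau>: "\<tau> > 0" "real n * \<tau> = T" using T N by (auto simp: \<tau>_def time_step_def)
  have tg: "tgrid T n k = real k * \<tau>" for k by (simp add: tgrid_def \<tau>_def)
  have le: "real i * \<tau> \<le> real j * \<tau>" if "i \<le> j" for i j using that \<tau> by (intro mult_right_mono) auto
  have leT: "real k * \<tau> \<le> T" if "k \<le> n" for k using le[OF that] \<tau>(2) by simp
  note i = W21_absolutely_integrable[OF q]
  have q'i: "(\<lambda>x. \<bar>q' x\<bar>) integrable_on {0..T}"
    using i(3) unfolding absolutely_integrable_on_def q'_def by simp
  have avg: "time_avg T n q k = integral {real (k - 1) * \<tau>..real k * \<tau>} q / (real k * \<tau> - real (k - 1) * \<tau>)"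
    if "k \<in> {1..n}" for k
    using time_avg_eq_integral[OF T i(1) that] by (simp add: tg)
  have less: "real (k - 1) * \<tau> < real k * \<tau>" if "k \<ge> 1" for k
    using that \<tau> by (intro mult_strict_right_mono) auto
  note diff = weak_deriv_average_difference[OF _ W21_weak_deriv[OF q], folded q'_def]
  have qL2: "q \<in> L2_on 0 T" using q by (simp add: W21_def)
  define W where "W = integral {0..T} (\<lambda>x. \<bar>q' x\<bar>)"
  have W: "W \<le> sqrt T * W21_norm 0 T q"
    using W21_integral_abs_le(2)[OF less_imp_le[OF T] q] by (simp add: W_def q'_def)
  have point: "\<bar>time_avg T n q k\<bar> \<le> W21_norm 0 T q / sqrt T + W" if k: "k \<in> {1..n}" for k
  proof -
    have "\<bar>time_avg T n q k - integral {0..T} q / (T - 0)\<bar> \<le> W"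
      unfolding avg[OF k] W_def using k less[of k] leT[of k] T \<tau> by (intro diff qL2) auto
    moreover have "\<bar>integral {0..T} q / T\<bar> \<le> sqrt T * W21_norm 0 T q / T"
      using W21_integral_abs_le(1)[OF less_imp_le[OF T] q] T by (simp add: divide_right_mono)
    moreover have "sqrt T * W21_norm 0 T q / T = W21_norm 0 T q / sqrt T"
      using T real_sqrt_mult_self[of T] by (simp add: field_simps)
    ultimately show ?thesis unfolding diff_zero by linarith
  qed
  have "(\<Sum>k=1..<N. \<bar>time_avg T n q (Suc k) - time_avg T n q k\<bar>)
      \<le> (\<Sum>k=1..<N. integral {real (k - 1) * \<tau>..real (Suc k) * \<tau>} (\<lambda>x. \<bar>q' x\<bar>))"
  proof (rule sum_mono)
    fix k assume k: "k \<in> {1..<N}"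
    hence kn: "k \<in> {1..n}" "Suc k \<in> {1..n}" using N by auto
    show "\<bar>time_avg T n q (Suc k) - time_avg T n q k\<bar>
        \<le> integral {real (k - 1) * \<tau>..real (Suc k) * \<tau>} (\<lambda>x. \<bar>q' x\<bar>)"
      unfolding avg[OF kn(1)] avg[OF kn(2)]
      using kn less[of k] less[of "Suc k"] leT[of "Suc k"] \<tau>(1) by (intro diff qL2) auto
  qed
  also have "\<dots> = (\<Sum>i<N - 1. integral {real i * \<tau>..real (Suc (Suc i)) * \<tau>} (\<lambda>x. \<bar>q' x\<bar>))"
    by (rule sum.reindex_bij_witness[of _ Suc "\<lambda>k. k - 1"]) auto
  also have "\<dots> \<le> 2 * W"
    unfolding W_def using \<tau> leT[of N] N by (intro sum_overlapping_integrals_le q'i) auto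
  finally show ?thesis
    using point[OF N] point[of 1] N W by (simp add: algebra_simps)
qed

lemma average_tendsto_endpoint:
  fixes f :: "real \<Rightarrow> real"
  assumes "a < b" "continuous_on {a..b} f"
  shows "((\<lambda>y. integral {y..b} f / (b - y)) \<longlongrightarrow> f b) (at b within {a..b})"
proof -
  have "((\<lambda>u. integral {u..b} f) has_real_derivative - f b) (at b within {a..b})"
    using integral_has_real_derivative'[OF assms(2), of b] assms(1) by simp
  hence "((\<lambda>y. integral {y..b} f / (y - b)) \<longlongrightarrow> - f b) (at b within {a..b})"
    by (simp add: has_field_derivative_iff)
  from tendsto_minus[OF this] show ?thesis
    by (simp add: minus_divide_right)
qed

text \<open>Both sums are controlled cell by cell with Cauchy's inequality. The last difference quotient
  compares a mean with the point value \<open>\<Phi> l\<close>, which by continuity is a limit of means over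
  intervals shrinking to \<open>l\<close>, so that the oscillation bound for means passes to the limit.\<close>

lemma Phi_disc_bounds:
  assumes l: "l > 0" and \<Phi>: "\<Phi> \<in> W21 0 l" and cont: "continuous_on {0..l} \<Phi>" and m: "m \<ge> 1"
  defines "h \<equiv> space_step l m"
  shows "(\<Sum>i<m. h * (Phi_disc l m \<Phi> i)\<^sup>2) \<le> (W21_norm 0 l \<Phi>)\<^sup>2"
    and "(\<Sum>i<m. h * (xdiff h (Phi_disc l m \<Phi>) i)\<^sup>2) \<le> 5 * (W21_norm 0 l \<Phi>)\<^sup>2"
proof -
  define \<Phi>' where "\<Phi>' = weak_deriv 0 l \<Phi>"
  define \<theta> where "\<theta> = Phi_disc l m \<Phi>"
  have h: "h > 0" "real m * h = l" using l m by (auto simp: h_def space_step_def)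
  have le: "real i * h \<le> real j * h" if "i \<le> j" for i j using that h by (intro mult_right_mono) auto
  have lel: "real k * h \<le> l" if "k \<le> m" for k using le[OF that] h(2) by simp
  note i = W21_absolutely_integrable[OF \<Phi>, folded \<Phi>'_def]
  note i' = i[THEN set_lebesgue_integral_eq_integral(1)]
  have \<Phi>L2: "\<Phi> \<in> L2_on 0 l" using \<Phi> by (simp add: W21_def)
  note diff = weak_deriv_average_difference[OF \<Phi>L2 W21_weak_deriv[OF \<Phi>], folded \<Phi>'_def]
  have avg: "\<theta> i = integral {real i * h..real (Suc i) * h} \<Phi> / (real (Suc i) * h - real i * h)" if "i < m" for i
  proof -
    have "\<Phi> absolutely_integrable_on {real i * h..real (Suc i) * h}"
      using h lel[of "Suc i"] that by (intro absolutely_integrable_on_subinterval[OF i(1)]) auto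
    from set_lebesgue_integral_eq_integral(2)[OF this] that show ?thesis
      by (simp add: \<theta>_def Phi_disc_def xgrid_def h_def[symmetric] algebra_simps)
  qed
  have cs: "(integral {real j * h..real k * h} w)\<^sup>2 \<le> (real k * h - real j * h) * integral {real j * h..real k * h} (\<lambda>x. (w x)\<^sup>2)"
    if "j \<le> k" "k \<le> m" "w integrable_on {0..l}" "(\<lambda>x. (w x)\<^sup>2) integrable_on {0..l}" for j k and w :: "real \<Rightarrow> real"
    using le[OF that(1)] lel[OF that(2)] h
    by (intro integral_power2_le integrable_on_subinterval[OF that(3)] integrable_on_subinterval[OF that(4)]) auto
  have nn: "integral {0..l} (\<lambda>x. (\<Phi> x)\<^sup>2) \<ge> 0" "integral {0..l} (\<lambda>x. (\<Phi>' x)\<^sup>2) \<ge> 0"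
    using i' by (auto intro: integral_nonneg)
  have norm: "(W21_norm 0 l \<Phi>)\<^sup>2 = integral {0..l} (\<lambda>x. (\<Phi> x)\<^sup>2) + integral {0..l} (\<lambda>x. (\<Phi>' x)\<^sup>2)"
    by (simp add: W21_norm_power2[OF \<Phi>] \<Phi>'_def)
  have hstep: "real (Suc i) * h - real i * h = h" for i by (simp add: algebra_simps)
  have "(\<Sum>i<m. h * (\<theta> i)\<^sup>2) \<le> (\<Sum>i<m. integral {real i * h..real (Suc i) * h} (\<lambda>x. (\<Phi> x)\<^sup>2))"
  proof (rule sum_mono)
    fix i assume i: "i \<in> {..<m}"
    have "(integral {real i * h..real (Suc i) * h} \<Phi>)\<^sup>2 \<le> h * integral {real i * h..real (Suc i) * h} (\<lambda>x. (\<Phi> x)\<^sup>2)"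
      using cs[of i "Suc i" \<Phi>] i i' unfolding hstep by auto
    thus "h * (\<theta> i)\<^sup>2 \<le> integral {real i * h..real (Suc i) * h} (\<lambda>x. (\<Phi> x)\<^sup>2)"
      using i h unfolding avg[OF i[unfolded lessThan_iff]] hstep
      by (simp add: power_divide power2_eq_square[of h] divide_le_eq mult.commute)
  qed
  also have "\<dots> = integral {0..l} (\<lambda>x. (\<Phi> x)\<^sup>2)"
    using sum_adjacent_integrals[of h _ l m] i' h by auto
  also have "\<dots> \<le> (W21_norm 0 l \<Phi>)\<^sup>2" using nn norm by simp
  finally show "(\<Sum>i<m. h * (Phi_disc l m \<Phi> i)\<^sup>2) \<le> (W21_norm 0 l \<Phi>)\<^sup>2" unfolding \<theta>_def .
  have a\<Phi>': "(\<lambda>x. \<bar>\<Phi>' x\<bar>) integrable_on {0..l}"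
    using i(3) unfolding absolutely_integrable_on_def by simp
  have sq: "h * (d / h)\<^sup>2 \<le> real (k - j) * integral {real j * h..real k * h} (\<lambda>x. (\<Phi>' x)\<^sup>2)"
    if "\<bar>d\<bar> \<le> integral {real j * h..real k * h} (\<lambda>x. \<bar>\<Phi>' x\<bar>)" "j \<le> k" "k \<le> m" for d j k
  proof -
    have "d\<^sup>2 \<le> (integral {real j * h..real k * h} (\<lambda>x. \<bar>\<Phi>' x\<bar>))\<^sup>2"
      using that(1) by (metis abs_ge_zero power2_abs power_mono)
    also have "\<dots> \<le> (real k * h - real j * h) * integral {real j * h..real k * h} (\<lambda>x. (\<Phi>' x)\<^sup>2)"
      using cs[of j k "\<lambda>x. \<bar>\<Phi>' x\<bar>"] that a\<Phi>' i' by simp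
    also have "\<dots> = h * (real (k - j) * integral {real j * h..real k * h} (\<lambda>x. (\<Phi>' x)\<^sup>2))"
      using that by (simp add: of_nat_diff algebra_simps)
    finally show ?thesis using h by (simp add: power_divide power2_eq_square[of h] divide_le_eq mult.commute)
  qed
  obtain M where M: "m = Suc M" using m by (cases m) auto
  have "h * (xdiff h \<theta> i)\<^sup>2 \<le> 2 * integral {real i * h..real (Suc (Suc i)) * h} (\<lambda>x. (\<Phi>' x)\<^sup>2)" if "i < M" for i
  proof -
    have "\<bar>\<theta> (Suc i) - \<theta> i\<bar> \<le> integral {real i * h..real (Suc (Suc i)) * h} (\<lambda>x. \<bar>\<Phi>' x\<bar>)"
      unfolding avg[of i, unfolded M, OF less_SucI[OF that]] avg[of "Suc i", unfolded M, OF Suc_mono[OF that]]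
      using that M h lel[of "Suc (Suc i)"] by (intro diff) auto
    from sq[OF this] that M show ?thesis by (simp add: xdiff_def)
  qed
  hence "(\<Sum>i<M. h * (xdiff h \<theta> i)\<^sup>2) \<le> 2 * (\<Sum>i<M. integral {real i * h..real (Suc (Suc i)) * h} (\<lambda>x. (\<Phi>' x)\<^sup>2))"
    unfolding sum_distrib_left by (intro sum_mono) auto
  moreover have "(\<Sum>i<M. integral {real i * h..real (Suc (Suc i)) * h} (\<lambda>x. (\<Phi>' x)\<^sup>2))
      \<le> 2 * integral {0..l} (\<lambda>x. (\<Phi>' x)\<^sup>2)"
    using h M i' by (intro sum_overlapping_integrals_le) auto
  moreover have "h * (xdiff h \<theta> M)\<^sup>2 \<le> integral {0..l} (\<lambda>x. (\<Phi>' x)\<^sup>2)"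
  proof -
    have lM: "real (Suc M) * h = l" using h M by simp
    have lt: "real M * h < l" using lM h by (simp add: algebra_simps)
    have lim: "((\<lambda>y. integral {y..l} \<Phi> / (l - y)) \<longlongrightarrow> \<Phi> l) (at l within {real M * h..l})"
      using h by (intro average_tendsto_endpoint lt continuous_on_subset[OF cont]) auto
    have nt: "at l within {real M * h..l} \<noteq> bot"
      using lt by (simp add: at_within_Icc_at_left)
    have "\<bar>\<Phi> l - \<theta> M\<bar> \<le> integral {real M * h..l} (\<lambda>x. \<bar>\<Phi>' x\<bar>)"
    proof (rule tendsto_upperbound[OF tendsto_rabs[OF tendsto_diff[OF lim tendsto_const]] _ nt])
      have "\<bar>integral {y..l} \<Phi> / (l - y) - \<theta> M\<bar> \<le> integral {real M * h..l} (\<lambda>x. \<bar>\<Phi>' x\<bar>)"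
        if "y \<in> {real M * h..l}" "y \<noteq> l" for y
        using avg[of M] that h lt unfolding lM M by (auto intro!: diff)
      thus "\<forall>\<^sub>F y in at l within {real M * h..l}. \<bar>integral {y..l} \<Phi> / (l - y) - \<theta> M\<bar> \<le> integral {real M * h..l} (\<lambda>x. \<bar>\<Phi>' x\<bar>)"
        by (auto simp: eventually_at_filter)
    qed
    hence "h * ((\<Phi> l - \<theta> M) / h)\<^sup>2 \<le> integral {real M * h..l} (\<lambda>x. (\<Phi>' x)\<^sup>2)"
      using sq[of "\<Phi> l - \<theta> M" M "Suc M"] M unfolding lM by simp
    also have "\<dots> \<le> integral {0..l} (\<lambda>x. (\<Phi>' x)\<^sup>2)"
      using h i' by (intro integral_subset_le integrable_on_subinterval[OF i'(4)]) auto
    finally show ?thesis by (simp add: xdiff_def \<theta>_def Phi_disc_def M)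
  qed
  ultimately show "(\<Sum>i<m. h * (xdiff h (Phi_disc l m \<Phi>) i)\<^sup>2) \<le> 5 * (W21_norm 0 l \<Phi>)\<^sup>2"
    using nn norm unfolding \<theta>_def[symmetric] unfolding M by simp
qed

section \<open>Piecewise linear interpolants\<close>

definition interpolant_slope :: "real \<Rightarrow> nat \<Rightarrow> (nat \<Rightarrow> real) \<Rightarrow> real \<Rightarrow> real" where
  "interpolant_slope T n g t = (\<Sum>k=1..n. indicator {tgrid T n (k - 1)..<tgrid T n k} t *
     ((g k - g (k - 1)) / time_step T n))"

lemma single_cell_sum:
  fixes c :: "nat \<Rightarrow> real"
  assumes T: "T > 0" and k: "k \<in> {1..n}" and t: "t \<in> {tgrid T n (k - 1)..<tgrid T n k}"
  shows "(\<Sum>j=1..n. indicator {tgrid T n (j - 1)..<tgrid T n j} t * c j) = c k"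
proof -
  have le: "tgrid T n i \<le> tgrid T n j" if "i \<le> j" for i j
    using that T unfolding tgrid_def time_step_def by (intro mult_right_mono) auto
  have "t \<notin> {tgrid T n (j - 1)..<tgrid T n j}" if "j \<in> {1..n}" "j \<noteq> k" for j
  proof -
    have "j \<le> k - 1 \<or> k \<le> j - 1" using that by auto
    thus ?thesis using t le[of j "k - 1"] le[of k "j - 1"] by auto
  qed
  hence "(\<Sum>j=1..n. indicator {tgrid T n (j - 1)..<tgrid T n j} t * c j) = (\<Sum>j=1..n. if j = k then c j else 0)"
    using t by (intro sum.cong) auto
  thus ?thesis using k by simp
qed

lemma interpolant_pieces:
  assumes T: "T > 0" and k: "k \<in> {1..n}" and t: "t \<in> {tgrid T n (k - 1)..<tgrid T n k}"
  shows "interpolant T n g t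
      = g (k - 1) + (g k - g (k - 1)) / time_step T n * (t - tgrid T n (k - 1))"
    and "interpolant_slope T n g t = (g k - g (k - 1)) / time_step T n"
  unfolding interpolant_def interpolant_slope_def by (rule single_cell_sum[OF assms])+

lemma indicator_sum_in_L2_on:
  fixes c :: "nat \<Rightarrow> real \<Rightarrow> real" and A :: "nat \<Rightarrow> real set"
  assumes "\<And>k. continuous_on UNIV (c k)" "\<And>k. A k \<in> sets borel"
  shows "(\<lambda>t. \<Sum>k\<in>K. indicator (A k) t * c k t) \<in> L2_on a b"
proof -
  let ?f = "\<lambda>t. \<Sum>k\<in>K. indicator (A k) t * c k t"
  let ?M = "lebesgue_on {a<..<b}"
  have "?f \<in> borel_measurable borel"
    using assms(2) borel_measurable_continuous_onI[OF assms(1)]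
    by (intro borel_measurable_sum borel_measurable_times borel_measurable_indicator) auto
  hence m: "?f \<in> borel_measurable ?M"
    by (intro measurable_restrict_space1 measurable_completion) simp
  have "\<exists>B. \<forall>t\<in>{a..b}. \<bar>c k t\<bar> \<le> B" for k
    using compact_imp_bounded[OF compact_continuous_image[OF continuous_on_subset[OF assms(1)], of "{a..b}" k]]
    by (auto simp: bounded_iff)
  then obtain B where B: "\<And>k t. t \<in> {a..b} \<Longrightarrow> \<bar>c k t\<bar> \<le> B k" by metis
  have bound: "\<bar>?f t\<bar> \<le> (\<Sum>k\<in>K. \<bar>B k\<bar>)" if "t \<in> {a<..<b}" for t
    using B[of t] that
    by (intro order_trans[OF sum_abs] sum_mono) (auto simp: indicator_def abs_mult intro: order_trans[OF B])
  interpret finite_measure ?M by (rule finite_measure_lebesgue_on) auto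
  have "integrable ?M (\<lambda>t. (?f t)\<^sup>2)"
  proof (rule integrable_const_bound)
    show "AE t in ?M. norm ((?f t)\<^sup>2) \<le> (\<Sum>k\<in>K. \<bar>B k\<bar>)\<^sup>2"
      using bound by (intro AE_I2) (auto simp: abs_le_square_iff[symmetric] intro!: order_trans[OF _ abs_ge_self])
  qed (use m in measurable)
  with m show ?thesis by (simp add: L2_on_def)
qed

text \<open>The weak derivative in the norm is an arbitrary choice, so the norm of the interpolant is meaningful
  only once some weak derivative is known to exist. On each cell the fundamental theorem of calculus
  evaluates \<open>\<integral> (g \<phi>' + g' \<phi>)\<close> to the increment of \<open>g \<phi>\<close>; by continuity of the piecewise linear
  function these increments telescope, and \<open>\<phi>\<close> vanishes at both ends.\<close>

lemma interpolant_in_W21: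
  assumes T: "T > 0" and n: "n \<ge> 1"
  shows "interpolant T n g \<in> W21 0 T"
proof -
  define \<tau> where "\<tau> = time_step T n"
  have \<tau>: "\<tau> > 0" "real n * \<tau> = T" using T n by (auto simp: \<tau>_def time_step_def)
  have tg: "tgrid T n k = real k * \<tau>" for k by (simp add: tgrid_def \<tau>_def)
  let ?p = "interpolant T n g" and ?q = "interpolant_slope T n g"
  have p: "?p \<in> L2_on 0 T" unfolding interpolant_def[abs_def]
    by (intro indicator_sum_in_L2_on continuous_intros) auto
  have q: "?q \<in> L2_on 0 T" unfolding interpolant_slope_def[abs_def]
    by (intro indicator_sum_in_L2_on continuous_intros) auto
  have "is_weak_deriv 0 T ?p ?q"
    unfolding is_weak_deriv_def
  proof (intro allI impI)
    fix \<phi> assume test: "test_function 0 T \<phi>"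
    then obtain D where D: "\<And>x. (\<phi> has_real_derivative D x) (at x)" "continuous_on UNIV D"
      by (auto simp: test_function_def C1_differentiable_on_def has_real_derivative_iff_has_vector_derivative)
    have dD: "deriv \<phi> = D" using D(1) by (auto intro!: DERIV_imp_deriv)
    have c\<phi>: "continuous_on UNIV \<phi>" using D(1) by (meson DERIV_isCont continuous_at_imp_continuous_on)
    obtain c d where "0 < c" "d < T" "\<forall>x. x \<notin> {c..d} \<longrightarrow> \<phi> x = 0"
      using test by (auto simp: test_function_def)
    hence \<phi>0: "\<phi> 0 = 0" "\<phi> T = 0" by auto
    have part: "((\<lambda>t. ?p t * D t + ?q t * \<phi> t) has_integral g k * \<phi> (real k * \<tau>) - g 0 * \<phi> 0) {0..real k * \<tau>}"
      if "k \<le> n" for k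
      using that
    proof (induction k)
      case (Suc k)
      let ?s = "(g (Suc k) - g k) / \<tau>"
      let ?L = "\<lambda>t. g k + ?s * (t - real k * \<tau>)"
      have lt: "real k * \<tau> < real (Suc k) * \<tau>" using \<tau> by simp
      have "((\<lambda>t. ?L t * D t + ?s * \<phi> t) has_integral
          ?L (real (Suc k) * \<tau>) * \<phi> (real (Suc k) * \<tau>) - ?L (real k * \<tau>) * \<phi> (real k * \<tau>))
          {real k * \<tau>..real (Suc k) * \<tau>}"
        using lt D(1)
        by (intro fundamental_theorem_of_calculus)
          (auto simp: has_real_derivative_iff_has_vector_derivative[symmetric]
            intro!: derivative_eq_intros has_field_derivative_at_within[OF D(1)])
      also have "?L (real (Suc k) * \<tau>) = g (Suc k)" using \<tau> by (simp add: field_simps)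
      also have "?L (real k * \<tau>) = g k" by simp
      finally have "((\<lambda>t. ?p t * D t + ?q t * \<phi> t) has_integral
          g (Suc k) * \<phi> (real (Suc k) * \<tau>) - g k * \<phi> (real k * \<tau>)) {real k * \<tau>..real (Suc k) * \<tau>}"
        \<comment> \<open>The cells are half open: the right end point belongs to the next piece.\<close>
      proof (rule has_integral_spike_finite[rotated 2])
        show "finite {real (Suc k) * \<tau>}" by simp
        fix t assume "t \<in> {real k * \<tau>..real (Suc k) * \<tau>} - {real (Suc k) * \<tau>}"
        hence t: "t \<in> {tgrid T n (Suc k - 1)..<tgrid T n (Suc k)}" by (auto simp: tg)
        show "?p t * D t + ?q t * \<phi> t = ?L t * D t + ?s * \<phi> t"
          using interpolant_pieces[OF T _ t] Suc.prems by (simp add: tg \<tau>_def[symmetric])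
      qed
      from has_integral_combine[OF _ _ Suc.IH this] Suc.prems \<tau> lt
      show ?case by auto
    qed (auto simp: has_integral_refl)
    have "integral {0..T} (\<lambda>t. ?p t * D t + ?q t * \<phi> t) = 0"
      using part[of n] \<phi>0 \<tau>(2) by (simp add: integral_unique)
    moreover have bm: "(\<lambda>t. w t * z t) absolutely_integrable_on {0..T}"
      if "w \<in> L2_on 0 T" "continuous_on UNIV z" for w z :: "real \<Rightarrow> real"
    proof -
      have "(\<lambda>t. z t * w t) absolutely_integrable_on {0..T}"
      proof (rule absolutely_integrable_bounded_measurable_product_real)
        have cz: "continuous_on {0..T} z" using that(2) continuous_on_subset by blast
        show "z \<in> borel_measurable (lebesgue_on {0..T})"
          by (intro continuous_imp_measurable_on_sets_lebesgue cz) auto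
        show "bounded (z ` {0..T})" by (intro compact_imp_bounded compact_continuous_image cz) auto
        show "w absolutely_integrable_on {0..T}" using L2_on_absolutely_integrable[OF that(1)] by simp
      qed auto
      thus ?thesis by (simp add: mult.commute)
    qed
    note i1 = bm[OF p D(2)] and i2 = bm[OF q c\<phi>]
    ultimately have "integral {0..T} (\<lambda>t. ?p t * D t) + integral {0..T} (\<lambda>t. ?q t * \<phi> t) = 0"
      using integral_add[OF set_lebesgue_integral_eq_integral(1)[OF i1] set_lebesgue_integral_eq_integral(1)[OF i2]]
      by simp
    thus "(LINT x|lebesgue_on {0<..<T}. ?p x * deriv \<phi> x) = - (LINT x|lebesgue_on {0<..<T}. ?q x * \<phi> x)"
      unfolding dD LINT_Ioo_eq_integral[OF i1] LINT_Ioo_eq_integral[OF i2] by simp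
  qed
  thus ?thesis using p q by (auto simp: W21_def)
qed

section \<open>Means of bounded sources\<close>

lemma mem_box_Pair_real:
  fixes a b c d x t :: real
  shows "(x, t) \<in> box (a, c) (b, d) \<longleftrightarrow> a < x \<and> x < b \<and> c < t \<and> t < d"
  by (auto simp: mem_box Basis_prod_def)

text \<open>The essential supremum is an extended real; finite from above by assumption, it is also nonnegative,
  because the domain contains a nonempty open set and the almost everywhere bound on \<open>\<bar>f\<bar>\<close> therefore
  holds at some point.\<close>

lemma Linf_AE_bound:
  assumes l: "l > 0" and T: "T > 0" and f: "f \<in> Linf (dom_D l T)"
  shows "Linf_norm (dom_D l T) f \<ge> 0"
    and "AE z in lebesgue. z \<in> dom_D l T \<longrightarrow> \<bar>f z\<bar> \<le> Linf_norm (dom_D l T) f"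
proof -
  let ?D = "dom_D l T" and ?b = "box (0, 0) (l, T) :: (real \<times> real) set"
  have D: "?D \<in> sets lebesgue" unfolding dom_D_def by (intro sets_completionI_sets) (simp add: borel_Times)
  define s where "s = Linf_esssup ?D f"
  have s: "s < \<infinity>" using f by (simp add: Linf_def s_def)
  have "AE z in lebesgue_on ?D. ereal \<bar>f z\<bar> \<le> s"
    unfolding s_def Linf_esssup_def by (rule esssup_AE)
  hence AE: "AE z in lebesgue. z \<in> ?D \<longrightarrow> ereal \<bar>f z\<bar> \<le> s"
    using D by (subst (asm) AE_restrict_space_iff) auto
  have "\<exists>z\<in>?D. ereal \<bar>f z\<bar> \<le> s"
  proof (rule ccontr)
    assume "\<not> ?thesis"
    with AE have "AE z in lebesgue. z \<notin> ?D" by (auto elim!: eventually_mono)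
    hence "negligible ?D" using D by (simp add: negligible_iff_null_sets AE_iff_null_sets)
    moreover have "?b \<subseteq> ?D" by (auto simp: dom_D_def mem_box_Pair_real)
    ultimately have "negligible ?b" by (rule negligible_subset)
    moreover have "(l / 2, T / 2) \<in> ?b" using l T by (auto simp: mem_box_Pair_real)
    ultimately show False using open_not_negligible[of ?b] by auto
  qed
  then obtain z where "ereal \<bar>f z\<bar> \<le> s" by auto
  hence "0 \<le> s" by (meson abs_ge_zero ereal_less_eq(5) order_trans)
  then obtain r where r: "s = ereal r" "r \<ge> 0" using s by (cases s) auto
  thus "Linf_norm ?D f \<ge> 0" by (simp add: Linf_norm_def s_def[symmetric])
  show "AE z in lebesgue. z \<in> ?D \<longrightarrow> \<bar>f z\<bar> \<le> Linf_norm ?D f"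
    using AE r by (simp add: Linf_norm_def s_def[symmetric])
qed

text \<open>The grid cells are closed and may stick out of the domain, but only by part of their boundary,
  which is a null set.\<close>

lemma f_disc_bound:
  assumes l: "l > 0" and T: "T > 0" and f: "f \<in> Linf (dom_D l T)" and "i < m" "k \<in> {1..n}"
  shows "\<bar>f_disc l T m n f i k\<bar> \<le> Linf_norm (dom_D l T) f"
proof -
  define h where "h = space_step l m"
  define \<tau> where "\<tau> = time_step T n"
  define s where "s = Linf_norm (dom_D l T) f"
  have h: "h > 0" "real m * h = l" using assms by (auto simp: h_def space_step_def)
  have \<tau>: "\<tau> > 0" "real n * \<tau> = T" using assms by (auto simp: \<tau>_def time_step_def)
  define S where "S = cbox (real i * h, real (k - 1) * \<tau>) (real (i + 1) * h, real k * \<tau>)"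
  define S' where "S' = box (real i * h, real (k - 1) * \<tau>) (real (i + 1) * h, real k * \<tau>)"
  have S: "{xgrid l m i..xgrid l m (i + 1)} \<times> {tgrid T n (k - 1)..tgrid T n k} = S"
    by (simp add: S_def xgrid_def tgrid_def h_def \<tau>_def cbox_Pair_eq)
  have le: "real (i + 1) * h \<le> real m * h" "real k * \<tau> \<le> real n * \<tau>"
    using assms h \<tau> by (auto intro!: mult_right_mono)
  have sub: "S' \<subseteq> dom_D l T"
  proof
    fix z assume "z \<in> S'"
    then obtain x t where z: "z = (x, t)" "real i * h < x" "x < real (i + 1) * h"
        "real (k - 1) * \<tau> < t" "t < real k * \<tau>"
      by (cases z) (auto simp: S'_def mem_box_Pair_real)
    moreover have "real i * h \<ge> 0" "real (k - 1) * \<tau> \<ge> 0" using h \<tau> by auto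
    ultimately show "z \<in> dom_D l T" using le h(2) \<tau>(2) by (auto simp: dom_D_def)
  qed
  have "AE z in lebesgue. z \<notin> S - S'"
    using negligible_frontier_interval unfolding S_def S'_def
    by (intro AE_not_in) (auto simp: negligible_iff_null_sets)
  hence AE: "AE z in lebesgue. \<bar>indicator S z *\<^sub>R f z\<bar> \<le> s * indicator S z"
    using Linf_AE_bound(2)[OF l T f] unfolding s_def
    by eventually_elim (use sub in \<open>auto simp: indicator_def\<close>)
  have le_h: "real i * h \<le> real (i + 1) * h" and le_\<tau>: "real (k - 1) * \<tau> \<le> real k * \<tau>"
    using h \<tau> by (auto intro!: mult_right_mono)
  have area: "measure lebesgue S = h * \<tau>"
    using assms le_h le_\<tau> unfolding S_def by (simp add: content_Pair algebra_simps of_nat_diff)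
  have int: "integrable lebesgue (\<lambda>z. s * indicator S z)"
    unfolding S_def by (intro integrable_mult_right integrable_real_indicator) (auto simp: emeasure_lborel_cbox_finite[unfolded infinity_ennreal_def])
  have "\<bar>LINT z:S|lebesgue. f z\<bar> \<le> (LINT z|lebesgue. s * indicator S z)"
    unfolding set_lebesgue_integral_def using Linf_AE_bound(1)[OF l T f] AE
    by (intro order_trans[OF integral_abs_bound] integral_mono_AE'[OF int]) (auto simp: s_def)
  also have "\<dots> = s * (h * \<tau>)" using area by (simp add: S_def)
  finally have "\<bar>LINT z:S|lebesgue. f z\<bar> \<le> s * (h * \<tau>)" .
  thus ?thesis
    using h \<tau> unfolding f_disc_def S h_def[symmetric] \<tau>_def[symmetric] s_def[symmetric]
    by (simp add: abs_mult divide_le_eq ac_simps)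
qed

section \<open>The discrete energy estimate\<close>

lemma young_inequality:
  fixes a z c :: real
  assumes "c > 0"
  shows "a * z \<le> c / 2 * z\<^sup>2 + a\<^sup>2 / (2 * c)"
  using zero_le_power2[of "c * z - a"] assms
  by (simp add: field_simps power2_eq_square)

text \<open>Two nodal values differ by at most the sum of \<open>h * \<bar>xdiff h w i\<bar>\<close>, whose square is at most \<open>l\<close>
  times the discrete Dirichlet sum. Averaging \<open>(w j)\<^sup>2 \<le> 2 * (w i)\<^sup>2 + 2 * (w j - w i)\<^sup>2\<close>
  over \<open>i\<close> gives the claim.\<close>

lemma discrete_trace_inequality:
  fixes w :: "nat \<Rightarrow> real"
  assumes h: "h > 0" and m: "m \<ge> 1" and l: "h * real m = l" and j: "j \<le> m"
  shows "(w j)\<^sup>2 \<le> 2 / l * (\<Sum>i<m. h * (w i)\<^sup>2) + 2 * l * (\<Sum>i<m. h * (xdiff h w i)\<^sup>2)"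
proof -
  define X where "X = (\<Sum>i<m. h * (xdiff h w i)\<^sup>2)"
  define D where "D = (\<Sum>i<m. h * \<bar>xdiff h w i\<bar>)"
  have lpos: "l > 0" using h m l by auto
  have step: "w (Suc i) - w i = h * xdiff h w i" for i
    using h by (simp add: xdiff_def)
  have le: "\<bar>w c - w a\<bar> \<le> D" if "a \<le> c" "c \<le> m" for a c
  proof -
    have "w c - w a = (\<Sum>i=a..<c. h * xdiff h w i)"
      using sum_Suc_diff'[OF that(1), of w] by (simp add: step)
    also have "\<bar>\<dots>\<bar> \<le> (\<Sum>i=a..<c. h * \<bar>xdiff h w i\<bar>)"
      using sum_abs[of "\<lambda>i. h * xdiff h w i" "{a..<c}"] h by (simp add: abs_mult)
    also have "\<dots> \<le> D"
      unfolding D_def using that h by (intro sum_mono2) auto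
    finally show ?thesis .
  qed
  have "D\<^sup>2 \<le> (\<Sum>i<m. (h * \<bar>xdiff h w i\<bar>)\<^sup>2) * real (card {..<m})"
    unfolding D_def by (rule sum_squared_le_sum_of_squares)
  also have "\<dots> = l * X"
    unfolding X_def l[symmetric] by (simp add: sum_distrib_left sum_distrib_right power2_eq_square algebra_simps)
  finally have D2: "D\<^sup>2 \<le> l * X" .
  have pt: "(w j)\<^sup>2 \<le> 2 * (w i)\<^sup>2 + 2 * (l * X)" if "i < m" for i
  proof -
    have "\<bar>w j - w i\<bar> \<le> D"
      using le[of i j] le[of j i] j that by (cases "i \<le> j") (auto simp: abs_minus_commute)
    hence "(w j - w i)\<^sup>2 \<le> D\<^sup>2"
      by (metis abs_ge_zero power2_abs power_mono)
    moreover have "(w j)\<^sup>2 \<le> 2 * (w i)\<^sup>2 + 2 * (w j - w i)\<^sup>2"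
      using zero_le_power2[of "w j - 2 * w i"] by (simp add: power2_eq_square algebra_simps)
    ultimately show ?thesis using D2 by linarith
  qed
  have "l * (w j)\<^sup>2 = (\<Sum>i<m. h * (w j)\<^sup>2)"
    using l by (simp add: mult.commute mult.left_commute)
  also have "\<dots> \<le> (\<Sum>i<m. h * (2 * (w i)\<^sup>2 + 2 * (l * X)))"
    using pt h by (intro sum_mono mult_left_mono) auto
  also have "\<dots> = 2 * (\<Sum>i<m. h * (w i)\<^sup>2) + 2 * l * (l * X)"
    unfolding l[symmetric] by (simp add: sum.distrib sum_distrib_left algebra_simps)
  finally show ?thesis
    using lpos unfolding X_def[symmetric] by (simp add: field_simps)
qed

lemma summation_by_parts_bound:
  fixes P w :: "nat \<Rightarrow> real"
  assumes N: "N \<ge> 1" and w: "\<And>k. k \<le> N \<Longrightarrow> \<bar>w k\<bar> \<le> W"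
  shows "\<bar>\<Sum>k=1..N. P k * (w k - w (k - 1))\<bar>
           \<le> (\<bar>P N\<bar> + \<bar>P 1\<bar> + (\<Sum>k=1..<N. \<bar>P (Suc k) - P k\<bar>)) * W"
proof -
  have eq: "(\<Sum>k=1..N. P k * (w k - w (k - 1)))
      = P N * w N - P 1 * w 0 - (\<Sum>k=1..<N. (P (Suc k) - P k) * w k)"
    using N
  proof (induction N rule: nat_induct_at_least)
    case (Suc n) thus ?case by (simp add: algebra_simps)
  qed (simp add: algebra_simps)
  have "\<bar>\<Sum>k=1..<N. (P (Suc k) - P k) * w k\<bar> \<le> (\<Sum>k=1..<N. \<bar>P (Suc k) - P k\<bar> * W)"
    using w by (intro order_trans[OF sum_abs] sum_mono) (auto simp: abs_mult intro!: mult_left_mono)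
  moreover have "\<bar>P N * w N\<bar> \<le> \<bar>P N\<bar> * W" "\<bar>P 1 * w 0\<bar> \<le> \<bar>P 1\<bar> * W"
    using w[of N] w[of 0] by (auto simp: abs_mult intro!: mult_left_mono)
  ultimately show ?thesis
    unfolding eq by (simp add: algebra_simps sum_distrib_left sum_distrib_right)
qed

text \<open>Testing the scheme with the increment \<open>v k - v (k - 1)\<close> yields, by strong monotonicity of \<open>\<beta>\<close>
  and the identity \<open>2 * x * (x - y) = x\<^sup>2 - y\<^sup>2 + (x - y)\<^sup>2\<close>, a one-step inequality whose sum over
  time controls \<open>S\<close>, \<open>Q\<close> and the Dirichlet sum at the last time summed over. The source
  is absorbed by Young's inequality.

  The boundary terms contain increments of the boundary values, for which no estimate is available;
  summation by parts moves the difference onto the data and leaves the boundary values themselves.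
  The trace inequality bounds their squares, uniformly in time, by a multiple of \<open>S + M\<close> and of the
  initial sums, since \<open>v k\<close> differs from \<open>v 0\<close> by a sum of increments that \<open>S\<close> controls. With a small
  factor \<open>\<delta>\<close> from Young's inequality the unknown part is absorbed on the left. The one-step inequalities
  are summed twice, up to \<open>n\<close> to bound \<open>S\<close> and \<open>Q\<close>, and up to a time at which the maximum \<open>M\<close> is
  attained.\<close>

lemma discrete_energy_estimate:
  fixes v :: "nat \<Rightarrow> nat \<Rightarrow> real" and \<beta> :: "real \<Rightarrow> real" and P G :: "nat \<Rightarrow> real"
    and f :: "nat \<Rightarrow> nat \<Rightarrow> real" and bP bG :: real
  assumes h: "h > 0" and \<tau>: "\<tau> > 0" and m: "m \<ge> 1" and n: "n \<ge> 1" and bbar: "bbar > 0"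
    and l: "h * real m = l" and T: "\<tau> * real n = T"
    and mono: "\<And>x y. bbar * (x - y)\<^sup>2 \<le> (\<beta> x - \<beta> y) * (x - y)"
    and scheme: "\<And>k \<eta>. k \<in> {1..n} \<Longrightarrow>
        (\<Sum>i<m. h * ((\<beta> (v k i) - \<beta> (v (k - 1) i)) / \<tau> * \<eta> i
                     + xdiff h (v k) i * xdiff h \<eta> i - f i k * \<eta> i))
        - P k * \<eta> m + G k * \<eta> 0 = 0"
    and f: "\<And>i k. i < m \<Longrightarrow> k \<in> {1..n} \<Longrightarrow> \<bar>f i k\<bar> \<le> \<phi>"
    and P: "\<And>N. N \<in> {1..n} \<Longrightarrow> \<bar>P N\<bar> + \<bar>P 1\<bar> + (\<Sum>k=1..<N. \<bar>P (Suc k) - P k\<bar>) \<le> bP"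
    and G: "\<And>N. N \<in> {1..n} \<Longrightarrow> \<bar>G N\<bar> + \<bar>G 1\<bar> + (\<Sum>k=1..<N. \<bar>G (Suc k) - G k\<bar>) \<le> bG"
    and \<delta>: "\<delta> > 0" "64 * \<delta> * T \<le> bbar * l" "32 * \<delta> * l \<le> 1"
  defines "S \<equiv> \<Sum>k=1..n. \<tau> * (\<Sum>i<m. h * ((v k i - v (k - 1) i) / \<tau>)\<^sup>2)"
    and "M \<equiv> MAX k\<in>{1..n}. \<Sum>i<m. h * (xdiff h (v k) i)\<^sup>2"
    and "Q \<equiv> \<Sum>k=1..n. \<tau>\<^sup>2 * (\<Sum>i<m. h * ((xdiff h (v k) i - xdiff h (v (k - 1)) i) / \<tau>)\<^sup>2)"
    and "V0 \<equiv> \<Sum>i<m. h * (v 0 i)\<^sup>2" and "X0 \<equiv> \<Sum>i<m. h * (xdiff h (v 0) i)\<^sup>2"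
  shows "min bbar 1 / 4 * (S + M + Q)
           \<le> 2 * X0 + T * l / bbar * \<phi>\<^sup>2 + (bP\<^sup>2 + bG\<^sup>2) / (2 * \<delta>) + 16 * \<delta> / l * V0"
proof -
  define Z where "Z k = (\<Sum>i<m. h * ((v k i - v (k - 1) i) / \<tau>)\<^sup>2)" for k
  define X where "X k = (\<Sum>i<m. h * (xdiff h (v k) i)\<^sup>2)" for k
  define Y where "Y k = (\<Sum>i<m. h * ((xdiff h (v k) i - xdiff h (v (k - 1)) i) / \<tau>)\<^sup>2)" for k
  define V where "V k = (\<Sum>i<m. h * (v k i)\<^sup>2)" for k
  have lpos: "l > 0" and Tpos: "T > 0" using h m l \<tau> n T by auto
  have S: "S = (\<Sum>k=1..n. \<tau> * Z k)" and M: "M = Max (X ` {1..n})"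
    and Q: "Q = (\<Sum>k=1..n. \<tau>\<^sup>2 * Y k)" and V0: "V0 = V 0" and X0: "X0 = X 0"
    by (simp_all add: S_def M_def Q_def V0_def X0_def Z_def X_def Y_def V_def)
  have nonneg: "Z k \<ge> 0" "X k \<ge> 0" "Y k \<ge> 0" "V k \<ge> 0" for k
    using h by (auto simp: Z_def X_def Y_def V_def intro!: sum_nonneg)
  have XM: "X k \<le> M" if "k \<in> {1..n}" for k
    unfolding M using that by (intro Max_ge) auto
  have M0: "M \<ge> 0" using XM[of 1] nonneg(2)[of 1] n by auto

  have step: "bbar / 2 * (\<tau> * Z k) + (X k - X (k - 1)) / 2 + \<tau>\<^sup>2 * Y k / 2
      \<le> \<tau> * l * \<phi>\<^sup>2 / (2 * bbar) + P k * (v k m - v (k - 1) m) - G k * (v k 0 - v (k - 1) 0)"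
    if k: "k \<in> {1..n}" for k
  proof -
    define \<eta> where "\<eta> i = v k i - v (k - 1) i" for i
    have x\<eta>: "xdiff h \<eta> i = xdiff h (v k) i - xdiff h (v (k - 1)) i" for i
      by (simp add: xdiff_def \<eta>_def diff_divide_distrib[symmetric])
    have pt: "bbar / 2 * (\<tau> * (\<eta> i / \<tau>)\<^sup>2) + ((xdiff h (v k) i)\<^sup>2 - (xdiff h (v (k - 1)) i)\<^sup>2) / 2
          + \<tau>\<^sup>2 * ((xdiff h (v k) i - xdiff h (v (k - 1)) i) / \<tau>)\<^sup>2 / 2 - \<tau> * \<phi>\<^sup>2 / (2 * bbar)
        \<le> (\<beta> (v k i) - \<beta> (v (k - 1) i)) / \<tau> * \<eta> i
                     + xdiff h (v k) i * xdiff h \<eta> i - f i k * \<eta> i" if i: "i < m" for i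
    proof -
      have "bbar * (\<tau> * (\<eta> i / \<tau>)\<^sup>2) = bbar * (\<eta> i)\<^sup>2 / \<tau>"
        using \<tau> by (simp add: power2_eq_square)
      also have "\<dots> \<le> (\<beta> (v k i) - \<beta> (v (k - 1) i)) * \<eta> i / \<tau>"
        using mono[of "v k i" "v (k - 1) i"] \<tau> by (intro divide_right_mono) (auto simp: \<eta>_def)
      finally have 1: "bbar * (\<tau> * (\<eta> i / \<tau>)\<^sup>2) \<le> (\<beta> (v k i) - \<beta> (v (k - 1) i)) / \<tau> * \<eta> i" by simp
      have 2: "xdiff h (v k) i * xdiff h \<eta> i = ((xdiff h (v k) i)\<^sup>2 - (xdiff h (v (k - 1)) i)\<^sup>2) / 2
          + \<tau>\<^sup>2 * ((xdiff h (v k) i - xdiff h (v (k - 1)) i) / \<tau>)\<^sup>2 / 2"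
        using \<tau> unfolding x\<eta> by (simp add: power_divide) (simp add: power2_eq_square field_simps)
      have "f i k * \<eta> i = \<tau> * (f i k * (\<eta> i / \<tau>))" using \<tau> by simp
      also have "\<dots> \<le> \<tau> * (bbar / 2 * (\<eta> i / \<tau>)\<^sup>2 + \<phi>\<^sup>2 / (2 * bbar))"
      proof (intro mult_left_mono)
        let ?z = "\<eta> i / \<tau>"
        have "(f i k)\<^sup>2 \<le> \<phi>\<^sup>2" using f[OF i k] by (metis abs_ge_zero power2_abs power_mono)
        moreover have "f i k * ?z \<le> bbar / 2 * ?z\<^sup>2 + (f i k)\<^sup>2 / (2 * bbar)"
          by (rule young_inequality[OF bbar])
        ultimately show "f i k * ?z \<le> bbar / 2 * ?z\<^sup>2 + \<phi>\<^sup>2 / (2 * bbar)"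
          using bbar by (smt (verit) divide_right_mono)
      qed (use \<tau> in auto)
      finally have 3: "f i k * \<eta> i \<le> bbar / 2 * (\<tau> * (\<eta> i / \<tau>)\<^sup>2) + \<tau> * \<phi>\<^sup>2 / (2 * bbar)"
        by (simp add: algebra_simps)
      show ?thesis using 1 2 3 by linarith
    qed
    have "(\<Sum>i<m. h * (bbar / 2 * (\<tau> * (\<eta> i / \<tau>)\<^sup>2) + ((xdiff h (v k) i)\<^sup>2 - (xdiff h (v (k - 1)) i)\<^sup>2) / 2
          + \<tau>\<^sup>2 * ((xdiff h (v k) i - xdiff h (v (k - 1)) i) / \<tau>)\<^sup>2 / 2 - \<tau> * \<phi>\<^sup>2 / (2 * bbar)))
        \<le> (\<Sum>i<m. h * ((\<beta> (v k i) - \<beta> (v (k - 1) i)) / \<tau> * \<eta> i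
                     + xdiff h (v k) i * xdiff h \<eta> i - f i k * \<eta> i))"
      using pt h by (intro sum_mono mult_left_mono) auto
    also have "\<dots> = P k * \<eta> m - G k * \<eta> 0" using scheme[OF k, of \<eta>] by linarith
    finally show ?thesis
      unfolding Z_def X_def Y_def \<eta>_def[symmetric] l[symmetric]
      by (simp add: sum.distrib sum_subtractf sum_distrib_left sum_divide_distrib algebra_simps diff_divide_distrib)
  qed

  have Vk: "V k \<le> 2 * V 0 + 2 * T * S" if k: "k \<le> n" for k
  proof -
    have pt: "(v k i)\<^sup>2 \<le> 2 * (v 0 i)\<^sup>2 + 2 * T * (\<Sum>j=1..n. \<tau> * ((v j i - v (j - 1) i) / \<tau>)\<^sup>2)" for i
    proof -
      have "v k i - v 0 i = (\<Sum>j=1..k. v j i - v (j - 1) i)"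
        by (induction k) (auto simp: algebra_simps)
      hence "(v k i - v 0 i)\<^sup>2 = (\<Sum>j=1..k. v j i - v (j - 1) i)\<^sup>2" by simp
      also have "\<dots> \<le> (\<Sum>j=1..k. (v j i - v (j - 1) i)\<^sup>2) * real (card {1..k})"
        by (rule sum_squared_le_sum_of_squares)
      also have "\<dots> \<le> (\<Sum>j=1..n. (v j i - v (j - 1) i)\<^sup>2) * real n"
        using k by (intro mult_mono sum_mono2 sum_nonneg) auto
      also have "\<dots> = T * (\<Sum>j=1..n. \<tau> * ((v j i - v (j - 1) i) / \<tau>)\<^sup>2)"
      proof -
        have "d\<^sup>2 * real n = T * (\<tau> * (d / \<tau>)\<^sup>2)" for d
          using \<tau> by (simp add: T[symmetric] power_divide power2_eq_square[of \<tau>])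
        thus ?thesis by (simp add: sum_distrib_left sum_distrib_right)
      qed
      finally show ?thesis
        using zero_le_power2[of "v k i - 2 * v 0 i"] by (simp add: power2_eq_square algebra_simps)
    qed
    have "V k \<le> (\<Sum>i<m. h * (2 * (v 0 i)\<^sup>2 + 2 * T * (\<Sum>j=1..n. \<tau> * ((v j i - v (j - 1) i) / \<tau>)\<^sup>2)))"
      unfolding V_def using pt h by (intro sum_mono mult_left_mono) auto
    also have "\<dots> = 2 * V 0 + 2 * T * (\<Sum>i<m. \<Sum>j=1..n. h * (\<tau> * ((v j i - v (j - 1) i) / \<tau>)\<^sup>2))"
      unfolding V_def by (simp add: sum.distrib sum_distrib_left algebra_simps)
    also have "(\<Sum>i<m. \<Sum>j=1..n. h * (\<tau> * ((v j i - v (j - 1) i) / \<tau>)\<^sup>2)) = S"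
      unfolding S_def by (subst sum.swap) (simp add: sum_distrib_left mult.left_commute)
    finally show ?thesis .
  qed

  define B where "B = 4 / l * V 0 + 4 * T / l * S + 2 * l * (M + X 0)"
  have trace: "(v k j)\<^sup>2 \<le> B" if "k \<le> n" "j \<le> m" for k j
  proof -
    have "(v k j)\<^sup>2 \<le> 2 / l * V k + 2 * l * X k"
      unfolding V_def X_def by (rule discrete_trace_inequality[OF h m l that(2)])
    also have "\<dots> \<le> 2 / l * (2 * V 0 + 2 * T * S) + 2 * l * (M + X 0)"
    proof (intro add_mono mult_left_mono Vk that)
      show "X k \<le> M + X 0" using XM[of k] that M0 nonneg(2)[of 0] by (cases "k = 0") auto
    qed (use lpos in auto)
    also have "\<dots> = B" by (simp add: B_def algebra_simps)
    finally show ?thesis .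
  qed
  have B0: "B \<ge> 0" using trace[of 0 0] by (meson order_trans zero_le_power2 le0)
  have young: "a * sqrt B \<le> \<delta> * B + a\<^sup>2 / (4 * \<delta>)" for a
    using young_inequality[of "2 * \<delta>" a "sqrt B"] \<delta>(1) B0 by simp
  have bdry: "\<bar>\<Sum>k=1..N. H k * (v k j - v (k - 1) j)\<bar> \<le> \<delta> * B + A\<^sup>2 / (4 * \<delta>)"
    if N: "N \<in> {1..n}" and j: "j \<le> m"
      and H: "\<bar>H N\<bar> + \<bar>H 1\<bar> + (\<Sum>k=1..<N. \<bar>H (Suc k) - H k\<bar>) \<le> A"
    for N j A and H :: "nat \<Rightarrow> real"
  proof -
    have "\<bar>\<Sum>k=1..N. H k * (v k j - v (k - 1) j)\<bar>
        \<le> (\<bar>H N\<bar> + \<bar>H 1\<bar> + (\<Sum>k=1..<N. \<bar>H (Suc k) - H k\<bar>)) * sqrt B"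
    proof (rule summation_by_parts_bound)
      fix k assume "k \<le> N"
      thus "\<bar>v k j\<bar> \<le> sqrt B" using trace[of k j] N j by (intro real_le_rsqrt) auto
    qed (use N in auto)
    also have "\<dots> \<le> A * sqrt B" by (intro mult_right_mono H) (use B0 in auto)
    finally show ?thesis using young[of A] by linarith
  qed

  define A where "A = X 0 / 2 + T * l * \<phi>\<^sup>2 / (2 * bbar) + (bP\<^sup>2 + bG\<^sup>2) / (4 * \<delta>) + 2 * \<delta> * B"
  have main: "bbar / 2 * (\<Sum>k=1..N. \<tau> * Z k) + X N / 2 + (\<Sum>k=1..N. \<tau>\<^sup>2 * Y k) / 2 \<le> A"
    if N: "N \<in> {1..n}" for N
  proof -
    have tele: "(\<Sum>k=1..N. (X k - X (k - 1)) / 2) = X N / 2 - X 0 / 2"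
      by (induction N) (auto simp: field_simps)
    have "bbar / 2 * (\<Sum>k=1..N. \<tau> * Z k) + (X N / 2 - X 0 / 2) + (\<Sum>k=1..N. \<tau>\<^sup>2 * Y k) / 2
        = (\<Sum>k=1..N. bbar / 2 * (\<tau> * Z k) + (X k - X (k - 1)) / 2 + \<tau>\<^sup>2 * Y k / 2)"
      unfolding tele[symmetric] by (simp add: sum.distrib sum_distrib_left sum_divide_distrib)
    also have "\<dots> \<le> (\<Sum>k=1..N. \<tau> * l * \<phi>\<^sup>2 / (2 * bbar) + P k * (v k m - v (k - 1) m) - G k * (v k 0 - v (k - 1) 0))"
      using N by (intro sum_mono step) auto
    also have "\<dots> = real N * (\<tau> * l * \<phi>\<^sup>2 / (2 * bbar)) + (\<Sum>k=1..N. P k * (v k m - v (k - 1) m))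
          - (\<Sum>k=1..N. G k * (v k 0 - v (k - 1) 0))"
      by (simp add: sum.distrib sum_subtractf)
    also have "real N * (\<tau> * l * \<phi>\<^sup>2 / (2 * bbar)) \<le> real n * (\<tau> * l * \<phi>\<^sup>2 / (2 * bbar))"
      using N \<tau> lpos bbar by (intro mult_right_mono) auto
    also have "\<dots> = T * l * \<phi>\<^sup>2 / (2 * bbar)" unfolding T[symmetric] by simp
    finally show ?thesis
      using bdry[OF N order.refl P[OF N]] bdry[OF N le0 G[OF N]]
      unfolding A_def by (simp add: add_divide_distrib)
  qed
  have S_le: "bbar / 2 * S + Q / 2 \<le> A"
    using main[of n] n nonneg(2)[of n] unfolding S Q by auto
  have "M \<in> X ` {1..n}" unfolding M using n by (intro Max_in) auto
  then obtain K where K: "K \<in> {1..n}" "M = X K" by auto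
  have "(\<Sum>k=1..K. \<tau> * Z k) \<ge> 0" "(\<Sum>k=1..K. \<tau>\<^sup>2 * Y k) \<ge> 0"
    using \<tau> nonneg by (auto intro!: sum_nonneg)
  hence "bbar / 2 * (\<Sum>k=1..K. \<tau> * Z k) \<ge> 0" "(\<Sum>k=1..K. \<tau>\<^sup>2 * Y k) / 2 \<ge> 0"
    using bbar by auto
  hence M_le: "M / 2 \<le> A" using main[OF K(1)] K(2) by linarith
  have S0: "S \<ge> 0" and Q0: "Q \<ge> 0"
    unfolding S Q using \<tau> nonneg by (auto intro!: sum_nonneg)
  have "4 * \<delta> * B = 16 * \<delta> / l * V 0 + 16 * \<delta> * T / l * S + 8 * \<delta> * l * M + 8 * \<delta> * l * X 0"
    by (simp add: B_def algebra_simps)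
  moreover have "16 * \<delta> * T / l * S \<le> bbar / 4 * S"
    using \<delta>(2) lpos S0 by (intro mult_right_mono) (auto simp: field_simps)
  moreover have "8 * \<delta> * l * M \<le> 1 / 4 * M" "8 * \<delta> * l * X 0 \<le> 1 / 4 * X 0"
    using \<delta>(3) M0 nonneg(2)[of 0] by (intro mult_right_mono; simp)+
  moreover have "min bbar 1 / 4 * (S + M + Q) \<le> bbar / 4 * S + 1 / 4 * M + 1 / 4 * Q"
    using mult_right_mono[of "min bbar 1" bbar S] mult_right_mono[of "min bbar 1" 1 "M + Q"] S0 M0 Q0
    by (simp add: algebra_simps)
  moreover have "2 * A = X 0 + T * l / bbar * \<phi>\<^sup>2 + (bP\<^sup>2 + bG\<^sup>2) / (2 * \<delta>) + 4 * \<delta> * B"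
    using \<delta>(1) bbar by (simp add: A_def field_simps)
  ultimately show ?thesis
    using S_le M_le Q0 M0 nonneg(2)[of 0] unfolding V0 X0 by linarith
qed

section \<open>The energy estimate in terms of the data\<close>

lemma strongly_monotone_of_deriv_ge:
  fixes \<beta> :: "real \<Rightarrow> real"
  assumes deriv: "\<And>v. \<exists>d\<ge>c. (\<beta> has_real_derivative d) (at v)"
  shows "c * (x - y)\<^sup>2 \<le> (\<beta> x - \<beta> y) * (x - y)"
proof -
  have *: "c * (y - x) \<le> \<beta> y - \<beta> x" if "x \<le> y" for x y
  proof -
    have "\<exists>d\<ge>0. ((\<lambda>v. \<beta> v - c * v) has_real_derivative d) (at v)" for v
    proof -
      obtain d where "d \<ge> c" "(\<beta> has_real_derivative d) (at v)" using deriv by blast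
      thus ?thesis by (intro exI[of _ "d - c"]) (auto intro!: derivative_eq_intros)
    qed
    from DERIV_nonneg_imp_nondecreasing[OF that, of "\<lambda>v. \<beta> v - c * v"] this
    show ?thesis by (auto simp: algebra_simps)
  qed
  show ?thesis
  proof (cases "x \<le> y")
    case True
    from mult_right_mono[OF *[OF True], of "y - x"] True show ?thesis
      by (simp add: power2_eq_square algebra_simps)
  next
    case False
    from mult_right_mono[OF *[of y x], of "x - y"] False show ?thesis
      by (simp add: power2_eq_square algebra_simps)
  qed
qed

theorem theorem4:
  fixes l T R a0 bbar :: real
    and J :: nat
    and u \<gamma> :: "nat \<Rightarrow> real"
    and \<alpha> k b :: "real \<Rightarrow> real"
  assumes "l > 0" "T > 0" "R > 0"
    and "J \<ge> 1"
    and "strict_mono_on {1..J} u"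
    and "\<forall>j\<in>{1..J}. \<gamma> j > 0"
    and "pos_piecewise_C1 J u \<alpha>"
    and "pos_piecewise_C1 J u k"
    and "(\<integral>\<^sup>+ y\<in>{u 1..}. ennreal (k y) \<partial>lborel) = \<infinity>"
    and "a0 > 0"
    and "Liminf at_top (\<lambda>y. ereal (\<alpha> y / k y)) \<ge> ereal a0"
    and "\<forall>v \<in> range (F_of k (u 1)) - (\<lambda>j. F_of k (u 1) (u j)) ` {1..J}.
           (b has_real_derivative beta_of \<alpha> k (u 1) v) (at v)"
    and "\<forall>j\<in>{1..J}. has_jump_at b (F_of k (u 1) (u j)) (\<gamma> j)"
    and "bbar > 0"
    and "\<forall>v. v \<notin> (\<lambda>j. F_of k (u 1) (u j)) ` {1..J} \<longrightarrow>
           (\<exists>d\<ge>bbar. (b has_real_derivative d) (at v))"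
    and "\<forall>n\<ge>1. \<forall>v. \<exists>d\<ge>bbar. (smoothed b n has_real_derivative d) (at v)"
  shows "\<exists>C>0. \<forall>p \<in> W21 0 T. \<forall>\<Phi> \<in> W21 0 l. \<forall>f \<in> Linf (dom_D l T).
           continuous_on {0..l} \<Phi> \<longrightarrow>
           (\<forall>j\<in>{1..J}. {x\<in>{0..l}. \<Phi> x = F_of k (u 1) (u j)} \<in> null_sets lebesgue) \<longrightarrow>
           (\<exists>N\<ge>1. \<forall>n\<ge>N. \<forall>m\<ge>N. \<forall>g \<in> control_set T R n. \<forall>v.
              discrete_state_vector l T b p \<Phi> f n m g v \<longrightarrow>
              energy_norm_sq l T n m v
                \<le> C * ((W21_norm 0 l \<Phi>)\<^sup>2 + (Linf_norm (dom_D l T) f)\<^sup>2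
                       + (W21_norm 0 T p)\<^sup>2 + (W21_norm 0 T (interpolant T n g))\<^sup>2))"
proof -
  have mono: "bbar * (x - y)\<^sup>2 \<le> (smoothed b n x - smoothed b n y) * (x - y)" if "n \<ge> 1" for n x y
    using assms(16) that by (intro strongly_monotone_of_deriv_ge) auto
  \<comment> \<open>The largest factor that the absorption in the energy estimate allows.\<close>
  define \<delta> where "\<delta> = min (bbar * l / (64 * T)) (1 / (32 * l))"
  define \<kappa> where "\<kappa> = 2 / sqrt T + 4 * sqrt T"
  define K where "K = 10 + T * l / bbar + \<kappa>\<^sup>2 / (2 * \<delta>) + 16 * \<delta> / l"
  define C where "C = 4 / min bbar 1 * K"
  note pos = assms(1,2,14)
  have \<delta>: "\<delta> > 0" "64 * \<delta> * T \<le> bbar * l" "32 * \<delta> * l \<le> 1"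
  proof -
    have "\<delta> \<le> bbar * l / (64 * T)" "\<delta> \<le> 1 / (32 * l)" by (auto simp: \<delta>_def)
    thus "64 * \<delta> * T \<le> bbar * l" "32 * \<delta> * l \<le> 1" using pos by (auto simp: field_simps)
    show "\<delta> > 0" using pos by (simp add: \<delta>_def)
  qed
  have Cpos: "C > 0"
    unfolding C_def K_def using pos \<delta>(1) by (intro mult_pos_pos add_pos_nonneg) auto
  have main: "energy_norm_sq l T n m v
      \<le> C * ((W21_norm 0 l \<Phi>)\<^sup>2 + (Linf_norm (dom_D l T) f)\<^sup>2
             + (W21_norm 0 T p)\<^sup>2 + (W21_norm 0 T (interpolant T n g))\<^sup>2)"
    if p: "p \<in> W21 0 T" and \<Phi>: "\<Phi> \<in> W21 0 l" and f: "f \<in> Linf (dom_D l T)"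
      and cont: "continuous_on {0..l} \<Phi>" and n: "n \<ge> 1" and m: "m \<ge> 1"
      and state: "discrete_state_vector l T b p \<Phi> f n m g v"
    for p \<Phi> f n m g v
  proof -
    define \<tau> where "\<tau> = time_step T n"
    define h where "h = space_step l m"
    have \<tau>: "\<tau> > 0" "\<tau> * real n = T" using pos n by (auto simp: \<tau>_def time_step_def)
    have h: "h > 0" "h * real m = l" using pos m by (auto simp: h_def space_step_def)
    have range: "{0..m - 1} = {..<m}" using m by auto
    have init: "v 0 i = Phi_disc l m \<Phi> i" if "i \<le> m" for i
      using state that by (simp add: discrete_state_vector_def Let_def)
    note scheme = state[unfolded discrete_state_vector_def Let_def range \<tau>_def[symmetric] h_def[symmetric],
        THEN conjunct2, rule_format]
    have gn: "interpolant T n g \<in> W21 0 T" by (rule interpolant_in_W21[OF pos(2) n])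
    let ?V0 = "\<Sum>i<m. h * (v 0 i)\<^sup>2" and ?X0 = "\<Sum>i<m. h * (xdiff h (v 0) i)\<^sup>2"
    let ?N\<Phi> = "W21_norm 0 l \<Phi>" and ?Nf = "Linf_norm (dom_D l T) f" and ?Np = "W21_norm 0 T p"
      and ?Ng = "W21_norm 0 T (interpolant T n g)"
    have "min bbar 1 / 4 * energy_norm_sq l T n m v
        \<le> 2 * ?X0 + T * l / bbar * ?Nf\<^sup>2 + ((\<kappa> * ?Np)\<^sup>2 + (\<kappa> * ?Ng)\<^sup>2) / (2 * \<delta>) + 16 * \<delta> / l * ?V0"
      unfolding energy_norm_sq_def Let_def range \<tau>_def[symmetric] h_def[symmetric] tdiff_def
      by (rule discrete_energy_estimate[where \<beta> = "smoothed b n" and f = "f_disc l T m n f"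
            and P = "time_avg T n p" and G = "time_avg T n (interpolant T n g)",
            OF h(1) \<tau>(1) m n pos(3) h(2) \<tau>(2) mono[OF n] scheme[unfolded tdiff_def]
              f_disc_bound[OF pos(1,2) f] time_avg_variation_le[OF pos(2) p, folded \<kappa>_def]
              time_avg_variation_le[OF pos(2) gn, folded \<kappa>_def] \<delta>])
    also have "?V0 = (\<Sum>i<m. h * (Phi_disc l m \<Phi> i)\<^sup>2)" using init by simp
    also have "?X0 = (\<Sum>i<m. h * (xdiff h (Phi_disc l m \<Phi>) i)\<^sup>2)" using init by (simp add: xdiff_def)
    also have "2 * (\<Sum>i<m. h * (xdiff h (Phi_disc l m \<Phi>) i)\<^sup>2) + T * l / bbar * ?Nf\<^sup>2
          + ((\<kappa> * ?Np)\<^sup>2 + (\<kappa> * ?Ng)\<^sup>2) / (2 * \<delta>) + 16 * \<delta> / l * (\<Sum>i<m. h * (Phi_disc l m \<Phi> i)\<^sup>2)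
        \<le> 2 * (5 * ?N\<Phi>\<^sup>2) + T * l / bbar * ?Nf\<^sup>2
          + ((\<kappa> * ?Np)\<^sup>2 + (\<kappa> * ?Ng)\<^sup>2) / (2 * \<delta>) + 16 * \<delta> / l * ?N\<Phi>\<^sup>2"
      using Phi_disc_bounds[OF pos(1) \<Phi> cont m] pos \<delta>(1) unfolding h_def
      by (intro add_mono mult_left_mono) auto
    also have "\<dots> = 10 * ?N\<Phi>\<^sup>2 + T * l / bbar * ?Nf\<^sup>2 + \<kappa>\<^sup>2 / (2 * \<delta>) * (?Np\<^sup>2 + ?Ng\<^sup>2) + 16 * \<delta> / l * ?N\<Phi>\<^sup>2"
      by (simp add: power_mult_distrib algebra_simps add_divide_distrib)
    also have "\<dots> \<le> K * (?N\<Phi>\<^sup>2 + ?Nf\<^sup>2 + ?Np\<^sup>2 + ?Ng\<^sup>2)"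
    proof -
      let ?s = "?N\<Phi>\<^sup>2 + ?Nf\<^sup>2 + ?Np\<^sup>2 + ?Ng\<^sup>2"
      have "T * l / bbar * ?Nf\<^sup>2 \<le> T * l / bbar * ?s" "16 * \<delta> / l * ?N\<Phi>\<^sup>2 \<le> 16 * \<delta> / l * ?s"
        "\<kappa>\<^sup>2 / (2 * \<delta>) * (?Np\<^sup>2 + ?Ng\<^sup>2) \<le> \<kappa>\<^sup>2 / (2 * \<delta>) * ?s" "10 * ?N\<Phi>\<^sup>2 \<le> 10 * ?s"
        using pos \<delta>(1) by (intro mult_left_mono; simp)+
      thus ?thesis unfolding K_def distrib_right by linarith
    qed
    finally have "4 / min bbar 1 * (min bbar 1 / 4 * energy_norm_sq l T n m v)
        \<le> 4 / min bbar 1 * (K * (?N\<Phi>\<^sup>2 + ?Nf\<^sup>2 + ?Np\<^sup>2 + ?Ng\<^sup>2))"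
      using pos by (intro mult_left_mono) auto
    moreover have "4 / min bbar 1 * (min bbar 1 / 4 * energy_norm_sq l T n m v) = energy_norm_sq l T n m v"
      using pos by (auto simp: min_def)
    ultimately show ?thesis unfolding C_def by (simp only: mult.assoc)
  qed
  show ?thesis
    using Cpos main by (intro exI[of _ C]) (auto intro!: exI[of _ "1::nat"])
qed

end
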